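(* Suppose that the number $r$ of plurihomogeneous polynomials $f_1,\dots,f_r$ is at most the number of variables of the first packet, i.e. $r\le n_1+1$. Then: 1. The Koszul complex is acyclic except in degree $0$: $H^i(K^\bullet)=0$ if $i\ne 0$. 2. If $r<n_1+1$, then $H^i_{\mathfrak{M}}(B)=0$ for $0\le i<n_1+1-r$.
   Context: Let $K$ be a commutative integral domain, $s\ge 1$, and $n_s\ge\dots\ge n_1\ge 1$ integers. For $1\le j\le s$ let $\underline{X}_j=(X_{j,1},\dots,X_{j,n_j+1})$ be a packet of indeterminates; for $\underline{\alpha}_j\in\mathbb{N}^{n_j+1}$ let $|\underline{\alpha}_j|$ be the sum of its entries and $\underline{X}_j^{\underline{\alpha}_j}$ the corresponding monomial. Let $r\in\mathbb{N}$ and $d_{i,j}\ge 1$ ($1\le i\le r$, $1\le j\le s$) be integers. Let $A=K[U_{i,\underline{\alpha}_1,\dots,\underline{\alpha}_s}]$ be the polynomial ring in indeterminates indexed by $1\le i\le r$ and $\underline{\alpha}_j\in\mathbb{N}^{n_j+1}$ with $|\underline{\alpha}_j|=d_{i,j}$ for all $j$. Let $C=A[\underline{X}_1,\dots,\underline{X}_s]$, $f_i=\sum U_{i,\underline{\alpha}_1,\dots,\underline{\alpha}_s}\underline{X}_1^{\underline{\alpha}_1}\cdots\underline{X}_s^{\underline{\alpha}_s}\in C$ (sum over all $(\underline{\alpha}_j)_j$ with $|\underline{\alpha}_j|=d_{i,j}$), and $B=C/(f_1,\dots,f_r)$. Let $\mathfrak{M}\subset C$ be the ideal generated by the monomials $\sigma_{i_1\dots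 i_s}=X_{1,i_1}\cdots X_{s,i_s}$, $1\le i_j\le n_j+1$. $K^\bullet$ is the Koszul complex of $f_1,\dots,f_r$ over $C$, placed in cohomological degrees $-r,\dots,0$: $K^{-l}=\bigwedge^l(C^r)$. For a $C$-module $M$, $H^i_{\mathfrak{M}}(M)$ denotes the $i$-th cohomology of the augmented Čech complex of $M$ with respect to the monomials $\sigma_{i_1\dots i_s}$, i.e. $0\to M\to\prod_{|I|=1}M_{\sigma_I}\to\prod_{|I|=2}M_{\sigma_I}\to\cdots$ with $M$ in degree $0$, where $I$ runs over sets of these monomials and $\sigma_I$ is their product. *)

theory Defs
  imports "HOL-Algebra.Product_Groups" "HOL-Algebra.QuotRing" "HOL-Algebra.Module" "HOL-Library.Poly_Mapping"
begin

section \<open>Cohomology, Koszul and Cech complexes\<close>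

text \<open>A cochain complex is given by its abelian groups \<open>G i\<close> (written multiplicatively, as in
  \<^const>\<open>product_group\<close>) and differentials \<open>d i\<close> from \<open>G i\<close> to \<open>G (i + 1)\<close>, with \<open>i\<close> an integer.
  Only the underlying groups are kept of complexes of modules.\<close>

definition cohomology ::
    "(int \<Rightarrow> ('a, 'b) monoid_scheme) \<Rightarrow> (int \<Rightarrow> 'a \<Rightarrow> 'a) \<Rightarrow> int \<Rightarrow> 'a set monoid" where
  "cohomology G d i =
     (G i)\<lparr>carrier := kernel (G i) (G (i + 1)) (d i)\<rparr> Mod (d (i - 1) ` carrier (G (i - 1)))"

definition index_sets :: "nat \<Rightarrow> int \<Rightarrow> nat set set" where
  "index_sets m l = {I. I \<subseteq> {..<m} \<and> int (card I) = l}"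

definition alt_sign :: "('a, 'b) ring_scheme \<Rightarrow> nat set \<Rightarrow> nat \<Rightarrow> 'a" where
  "alt_sign R I k = (\<ominus>\<^bsub>R\<^esub> \<one>\<^bsub>R\<^esub>) [^]\<^bsub>R\<^esub> card {j \<in> I. j < k}"

text \<open>The \<open>l\<close>-th exterior power of \<open>R\<^sup>r\<close> is the free module on the elements
  \<open>e\<^sub>I = e\<^sub>i\<^sub>1 \<and> \<dots> \<and> e\<^sub>i\<^sub>l\<close> for \<open>I = {i\<^sub>1 < \<dots> < i\<^sub>l} \<subseteq> {0, \<dots>, r - 1}\<close>; an element is the family of its
  coordinates.  It sits in degree \<open>-l\<close>, and the differential sends \<open>e\<^sub>J\<close> to the sum over \<open>k \<in> J\<close> of
  \<open>(-1)\<close> to the number of \<open>j \<in> J\<close> below \<open>k\<close>, times \<open>f\<^sub>k e\<^bsub>J - {k}\<^esub>\<close>.\<close>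

definition koszul_group :: "('a, 'b) ring_scheme \<Rightarrow> 'a list \<Rightarrow> int \<Rightarrow> (nat set \<Rightarrow> 'a) monoid" where
  "koszul_group R fs i = product_group (index_sets (length fs) (- i)) (\<lambda>_. add_monoid R)"

definition koszul_diff ::
    "('a, 'b) ring_scheme \<Rightarrow> 'a list \<Rightarrow> int \<Rightarrow> (nat set \<Rightarrow> 'a) \<Rightarrow> nat set \<Rightarrow> 'a" where
  "koszul_diff R fs i x =
     (\<lambda>I \<in> index_sets (length fs) (- (i + 1)).
        \<Oplus>\<^bsub>R\<^esub>k \<in> {..<length fs} - I. alt_sign R I k \<otimes>\<^bsub>R\<^esub> (fs ! k \<otimes>\<^bsub>R\<^esub> x (insert k I)))"

definition koszul_cohomology ::
    "('a, 'b) ring_scheme \<Rightarrow> 'a list \<Rightarrow> int \<Rightarrow> (nat set \<Rightarrow> 'a) set monoid" where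
  "koszul_cohomology R fs = cohomology (koszul_group R fs) (koszul_diff R fs)"

text \<open>The localization \<open>M\<^sub>g\<close>: the pair \<open>(m, a)\<close> stands for the fraction \<open>m / g\<^sup>a\<close>.\<close>

definition loc_rel ::
    "('a, 'b) ring_scheme \<Rightarrow> ('a, 'c, 'd) module_scheme \<Rightarrow> 'a \<Rightarrow> (('c \<times> nat) \<times> ('c \<times> nat)) set" where
  "loc_rel R M g =
     {((m, a), (m', b)). m \<in> carrier M \<and> m' \<in> carrier M \<and>
        (\<exists>c::nat. (g [^]\<^bsub>R\<^esub> (c + b)) \<odot>\<^bsub>M\<^esub> m = (g [^]\<^bsub>R\<^esub> (c + a)) \<odot>\<^bsub>M\<^esub> m')}"

definition loc_frac ::
    "('a, 'b) ring_scheme \<Rightarrow> ('a, 'c, 'd) module_scheme \<Rightarrow> 'a \<Rightarrow> 'c \<Rightarrow> nat \<Rightarrow> ('c \<times> nat) set" where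
  "loc_frac R M g m a = loc_rel R M g `` {(m, a)}"

text \<open>The fields \<^const>\<open>monoid.mult\<close> and \<^const>\<open>one\<close> carry no information in a module record.\<close>

definition localization ::
    "('a, 'b) ring_scheme \<Rightarrow> ('a, 'c, 'd) module_scheme \<Rightarrow> 'a \<Rightarrow> ('a, ('c \<times> nat) set) module" where
  "localization R M g =
     \<lparr>carrier = (carrier M \<times> UNIV) // loc_rel R M g,
      monoid.mult = (\<lambda>_ _. undefined), one = undefined,
      ring.zero = loc_frac R M g \<zero>\<^bsub>M\<^esub> 0,
      add = (\<lambda>P Q. \<Union>(m, a)\<in>P. \<Union>(m', b)\<in>Q.
               loc_frac R M g ((g [^]\<^bsub>R\<^esub> b) \<odot>\<^bsub>M\<^esub> m \<oplus>\<^bsub>M\<^esub> (g [^]\<^bsub>R\<^esub> a) \<odot>\<^bsub>M\<^esub> m') (a + b)),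
      smult = (\<lambda>c P. \<Union>(m, a)\<in>P. loc_frac R M g (c \<odot>\<^bsub>M\<^esub> m) a)\<rparr>"

text \<open>The canonical map from \<open>M\<^sub>g\<close> to \<open>M\<^bsub>g h\<^esub>\<close>, which sends \<open>m / g\<^sup>a\<close> to \<open>h\<^sup>a m / (g h)\<^sup>a\<close>.\<close>

definition loc_map ::
    "('a, 'b) ring_scheme \<Rightarrow> ('a, 'c, 'd) module_scheme \<Rightarrow> 'a \<Rightarrow> 'a \<Rightarrow> ('c \<times> nat) set \<Rightarrow> ('c \<times> nat) set"
  where
  "loc_map R M g h P = (\<Union>(m, a)\<in>P. loc_frac R M (g \<otimes>\<^bsub>R\<^esub> h) ((h [^]\<^bsub>R\<^esub> a) \<odot>\<^bsub>M\<^esub> m) a)"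

definition prod_of :: "('a, 'b) ring_scheme \<Rightarrow> 'a list \<Rightarrow> nat set \<Rightarrow> 'a" where
  "prod_of R xs I = (\<Otimes>\<^bsub>R\<^esub>k \<in> I. xs ! k)"

text \<open>The augmented Cech complex of \<open>M\<close> with respect to the list \<open>xs\<close>: in degree \<open>i\<close> the product of
  the localizations of \<open>M\<close> at the products of \<open>i\<close> members of \<open>xs\<close> (sets of members are given by
  their sets of positions).  In degree \<open>0\<close> this is the
  localization at the empty product \<open>1\<close>, which is \<open>M\<close> itself up to the isomorphism \<open>m \<mapsto> m / 1\<close>.\<close>

definition cech_group ::
    "('a, 'b) ring_scheme \<Rightarrow> ('a, 'c, 'd) module_scheme \<Rightarrow> 'a list \<Rightarrow> int
       \<Rightarrow> (nat set \<Rightarrow> ('c \<times> nat) set) monoid" where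
  "cech_group R M xs i =
     product_group (index_sets (length xs) i)
       (\<lambda>I. add_monoid (localization R M (prod_of R xs I)))"

definition cech_diff ::
    "('a, 'b) ring_scheme \<Rightarrow> ('a, 'c, 'd) module_scheme \<Rightarrow> 'a list \<Rightarrow> int
       \<Rightarrow> (nat set \<Rightarrow> ('c \<times> nat) set) \<Rightarrow> nat set \<Rightarrow> ('c \<times> nat) set" where
  "cech_diff R M xs i x =
     (\<lambda>J \<in> index_sets (length xs) (i + 1).
        \<Oplus>\<^bsub>localization R M (prod_of R xs J)\<^esub>k \<in> J.
          alt_sign R J k \<odot>\<^bsub>localization R M (prod_of R xs J)\<^esub>
            loc_map R M (prod_of R xs (J - {k})) (xs ! k) (x (J - {k})))"

definition cech_cohomology ::
    "('a, 'b) ring_scheme \<Rightarrow> ('a, 'c, 'd) module_scheme \<Rightarrow> 'a list \<Rightarrow> int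
       \<Rightarrow> (nat set \<Rightarrow> ('c \<times> nat) set) set monoid" where
  "cech_cohomology R M xs = cohomology (cech_group R M xs) (cech_diff R M xs)"

text \<open>The quotient ring \<open>R / I\<close> regarded as an \<open>R\<close>-module.\<close>

definition quotient_module :: "('a, 'b) ring_scheme \<Rightarrow> 'a set \<Rightarrow> ('a, 'a set) module" where
  "quotient_module R I =
     ring.extend (R Quot I) \<lparr>smult = (\<lambda>a P. (I +>\<^bsub>R\<^esub> a) \<otimes>\<^bsub>R Quot I\<^esub> P)\<rparr>"


section \<open>Generic plurihomogeneous polynomials\<close>

text \<open>For a subring \<open>S\<close> of \<open>'a\<close>, the polynomial ring \<open>S[V]\<close> in the indeterminates \<open>V\<close>: polynomials
  with coefficients in \<open>S\<close> and monomials supported on \<open>V\<close>.\<close>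

definition poly_over :: "'a set \<Rightarrow> 'v set \<Rightarrow> (('v \<Rightarrow>\<^sub>0 nat) \<Rightarrow>\<^sub>0 'a::comm_ring_1) set" where
  "poly_over S V =
     {p. (\<forall>m. Poly_Mapping.lookup p m \<in> S) \<and>
         (\<forall>m \<in> Poly_Mapping.keys p. Poly_Mapping.keys m \<subseteq> V)}"

definition ring_of_set :: "'a::comm_ring_1 set \<Rightarrow> 'a ring" where
  "ring_of_set S =
     \<lparr>carrier = S, monoid.mult = (*), one = 1, ring.zero = 0, add = (+)\<rparr>"

text \<open>The pair \<open>(j, k)\<close> is the index of \<open>X\<^bsub>j,k\<^esub>\<close>.  A tuple of exponents
  \<open>(\<alpha>\<^sub>1, \<dots>, \<alpha>\<^sub>s)\<close> is encoded as the single exponent \<open>\<alpha>\<close> with \<open>lookup \<alpha> (j, k) = \<alpha>\<^bsub>j,k\<^esub>\<close>, and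
  \<open>(i, \<alpha>)\<close> is the index of \<open>U\<^bsub>i,\<alpha>\<^esub>\<close>.\<close>

type_synonym expo = "(nat \<times> nat) \<Rightarrow>\<^sub>0 nat"
type_synonym 'k coeff_poly = "((nat \<times> expo) \<Rightarrow>\<^sub>0 nat) \<Rightarrow>\<^sub>0 'k"
type_synonym 'k gen_poly = "expo \<Rightarrow>\<^sub>0 'k coeff_poly"

definition X_vars :: "nat \<Rightarrow> (nat \<Rightarrow> nat) \<Rightarrow> (nat \<times> nat) set" where
  "X_vars s n = (SIGMA j:{1..s}. {1..n j + 1})"

definition expos :: "nat \<Rightarrow> (nat \<Rightarrow> nat) \<Rightarrow> (nat \<Rightarrow> nat) \<Rightarrow> expo set" where
  "expos s n e =
     {\<alpha>. Poly_Mapping.keys \<alpha> \<subseteq> X_vars s n \<and>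
         (\<forall>j \<in> {1..s}. (\<Sum>k = 1..n j + 1. Poly_Mapping.lookup \<alpha> (j, k)) = e j)}"

definition U_vars ::
    "nat \<Rightarrow> (nat \<Rightarrow> nat) \<Rightarrow> nat \<Rightarrow> (nat \<Rightarrow> nat \<Rightarrow> nat) \<Rightarrow> (nat \<times> expo) set" where
  "U_vars s n r d = (SIGMA i:{1..r}. expos s n (d i))"

definition ring_A ::
    "nat \<Rightarrow> (nat \<Rightarrow> nat) \<Rightarrow> nat \<Rightarrow> (nat \<Rightarrow> nat \<Rightarrow> nat) \<Rightarrow> 'k::idom coeff_poly set" where
  "ring_A s n r d = poly_over UNIV (U_vars s n r d)"

definition ring_C ::
    "nat \<Rightarrow> (nat \<Rightarrow> nat) \<Rightarrow> nat \<Rightarrow> (nat \<Rightarrow> nat \<Rightarrow> nat) \<Rightarrow> 'k::idom gen_poly ring" where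
  "ring_C s n r d = ring_of_set (poly_over (ring_A s n r d) (X_vars s n))"

definition var_U :: "nat \<Rightarrow> expo \<Rightarrow> 'k::idom coeff_poly" where
  "var_U i \<alpha> = Poly_Mapping.single (Poly_Mapping.single (i, \<alpha>) 1) 1"

definition var_X :: "nat \<Rightarrow> nat \<Rightarrow> 'k::idom gen_poly" where
  "var_X j k = Poly_Mapping.single (Poly_Mapping.single (j, k) 1) 1"

text \<open>\<^term>\<open>Poly_Mapping.single \<alpha> u\<close> is the term with coefficient \<open>u\<close> and exponent \<open>\<alpha>\<close>.\<close>

definition generic_poly :: "nat \<Rightarrow> (nat \<Rightarrow> nat) \<Rightarrow> (nat \<Rightarrow> nat \<Rightarrow> nat) \<Rightarrow> nat \<Rightarrow> 'k::idom gen_poly" where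
  "generic_poly s n d i = (\<Sum>\<alpha> \<in> expos s n (d i). Poly_Mapping.single \<alpha> (var_U i \<alpha>))"

definition generic_polys ::
    "nat \<Rightarrow> (nat \<Rightarrow> nat) \<Rightarrow> nat \<Rightarrow> (nat \<Rightarrow> nat \<Rightarrow> nat) \<Rightarrow> 'k::idom gen_poly list" where
  "generic_polys s n r d = map (generic_poly s n d) [1..<r + 1]"

definition module_B ::
    "nat \<Rightarrow> (nat \<Rightarrow> nat) \<Rightarrow> nat \<Rightarrow> (nat \<Rightarrow> nat \<Rightarrow> nat)
       \<Rightarrow> ('k::idom gen_poly, 'k gen_poly set) module" where
  "module_B s n r d =
     quotient_module (ring_C s n r d) (Idl\<^bsub>ring_C s n r d\<^esub> (set (generic_polys s n r d)))"

text \<open>The monomials \<open>X\<^bsub>1,i\<^sub>1\<^esub> \<dots> X\<^bsub>s,i\<^sub>s\<^esub>\<close>, listed without repetition in the lexicographic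
  order of \<open>(i\<^sub>1, \<dots>, i\<^sub>s)\<close>.\<close>

definition sigmas :: "nat \<Rightarrow> (nat \<Rightarrow> nat) \<Rightarrow> 'k::idom gen_poly list" where
  "sigmas s n =
     map (\<lambda>t. \<Prod>j = 1..s. var_X j (t ! (j - 1)))
       (product_lists (map (\<lambda>j. [1..<n j + 2]) [1..<s + 1]))"


text \<open>The sum defining \<^const>\<open>generic_poly\<close> is finite.\<close>

lemma finite_expos: "finite (expos s n e)"
proof -
  let ?V = "X_vars s n"
  have fin: "finite ?V" by (simp add: X_vars_def)
  define b where "b = (\<Sum>j\<in>{1..s}. e j)"
  have "Poly_Mapping.lookup ` expos s n e
      \<subseteq> {f. \<forall>v. (v \<in> ?V \<longrightarrow> f v \<in> {..b}) \<and> (v \<notin> ?V \<longrightarrow> f v = 0)}"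
  proof safe
    fix \<alpha> j k assume a: "\<alpha> \<in> expos s n e" and v: "(j, k) \<in> ?V"
    then have j: "j \<in> {1..s}" and k: "k \<in> {1..n j + 1}" by (auto simp: X_vars_def)
    have "Poly_Mapping.lookup \<alpha> (j, k) \<le> (\<Sum>k = 1..n j + 1. Poly_Mapping.lookup \<alpha> (j, k))"
      using k by (intro member_le_sum) auto
    also have "\<dots> = e j" using a j by (auto simp: expos_def)
    also have "\<dots> \<le> b" unfolding b_def using j by (intro member_le_sum) auto
    finally show "Poly_Mapping.lookup \<alpha> (j, k) \<le> b" .
  next
    fix \<alpha> j k assume a: "\<alpha> \<in> expos s n e" and v: "(j, k) \<notin> ?V"
    then have "(j, k) \<notin> Poly_Mapping.keys \<alpha>" by (auto simp: expos_def)
    then show "Poly_Mapping.lookup \<alpha> (j, k) = 0" by (simp add: in_keys_iff)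
  qed
  moreover have "finite {f. \<forall>v. (v \<in> ?V \<longrightarrow> f v \<in> {..b}) \<and> (v \<notin> ?V \<longrightarrow> f v = (0::nat))}"
    by (rule finite_set_of_finite_funs[OF fin]) simp
  ultimately have "finite (Poly_Mapping.lookup ` expos s n e)" by (rule finite_subset)
  moreover have "inj_on Poly_Mapping.lookup (expos s n e)"
    by (rule inj_onI) (rule poly_mapping_eqI, simp)
  ultimately show ?thesis by (rule finite_imageD)
qed

end

theory Submission
  imports Defs "HOL.Modules"
begin

text \<open>
  Both parts rest on one regular sequence of length \<open>n\<^sub>1 + 1\<close> in the polynomial ring.  For
  \<open>i \<le> r\<close> the polynomial \<open>f\<^sub>i\<close> contains the term whose monomial is the product of
  the \<open>d\<^bsub>i,j\<^esub>\<close>-th powers of \<open>X\<^bsub>j,i\<^esub>\<close> over all packets \<open>j\<close>; this index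
  exists in every packet because \<open>i \<le> n\<^sub>1 + 1 \<le> n\<^sub>j + 1\<close>.  The coefficient of that term is
  a variable \<open>U\<close> that occurs nowhere else in the sequence.  For \<open>r < k \<le> n\<^sub>1 + 1\<close> take the
  \<open>N\<close>-th power of \<open>\<sigma>\<^bsub>k\<dots>k\<^esub>\<close>.  The chosen terms and powers are pairwise coprime
  monomials, so they form a regular sequence (\<open>coprime_monomials_nonzerodivisor\<close>).  Each
  \<open>f\<^sub>i\<close> differs from its chosen term by terms free of its private variable \<open>U\<close>, and
  comparing components of equal degree in \<open>U\<close> shows that such a change keeps an element a
  nonzerodivisor (\<open>nonzerodivisor_mod_deform\<close>).  Replacing the monomials by the \<open>f\<^sub>i\<close> one
  at a time (\<open>regular_seq_deformation\<close>) gives the regular sequence.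

  If a list contains, among its members, a sequence of length \<open>t\<close> that is regular modulo an ideal
  \<open>I\<close>, then the Koszul cohomology of the list modulo \<open>I\<close> vanishes below degree \<open>t\<close>
  (\<open>koszul_vanishing\<close>).  For the list \<open>f\<^sub>1, \<dots>, f\<^sub>r\<close> and \<open>I = 0\<close> this is the first
  part, once index sets are replaced by their complements.  For the second part, a Cech cochain with
  values in the localizations of \<open>B\<close> can be written with one common exponent \<open>N\<close> in all
  denominators.  After an increase of \<open>N\<close>, its numerators form a Koszul cocycle of the \<open>N\<close>-th
  powers of the \<open>\<sigma>\<close> modulo \<open>(f\<^sub>1, \<dots>, f\<^sub>r)\<close> whenever it is a Cech cocycle, and a
  Koszul coboundary gives a Cech coboundary (\<open>cech_vanishing\<close>).  The \<open>N\<close>-th powers of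
  \<open>\<sigma>\<^bsub>k\<dots>k\<^esub>\<close> for \<open>r < k \<le> n\<^sub>1 + 1\<close> are the regular sequence that
  \<open>koszul_vanishing\<close> asks for.

  All of this algebra takes place in the type of polynomials in infinitely many variables, which is a
  commutative ring.  The ring \<open>C\<close> is a subring with a \<open>C\<close>-linear projection from the whole
  type onto it, and this projection moves the cochains found in the big ring into \<open>C\<close>
  (locale \<open>retract_subring\<close>).
\<close>

section \<open>Koszul cochains modulo an ideal\<close>

text \<open>Ideals of a ring given by a type are the submodules of the ring over itself, so the ideal generated
  by \<open>S\<close> is the span of \<open>S\<close>.\<close>

interpretation ring_module: Modules.module "(*) :: 'a::comm_ring_1 \<Rightarrow> 'a \<Rightarrow> 'a"
  by standard (simp_all add: algebra_simps)

(* As a rewrite rule this re-associates products to the left and loops with mult_ac. *)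
declare ring_module.scale_scale [simp del]

lemma ideal_mult_left: "a \<in> ring_module.span S \<Longrightarrow> b * a \<in> ring_module.span S"
  for a :: "'a::comm_ring_1"
  by (rule ring_module.span_scale)

lemma ideal_mult_right: "a \<in> ring_module.span S \<Longrightarrow> a * b \<in> ring_module.span S"
  for a :: "'a::comm_ring_1"
  using ideal_mult_left[of a S b] by (simp add: mult.commute)

definition pos_sign :: "nat set \<Rightarrow> nat \<Rightarrow> 'a::comm_ring_1" where
  "pos_sign J k = (- 1) ^ card {j \<in> J. j < k}"

lemma pos_sign_square: "pos_sign J k * pos_sign J k = 1"
  by (simp add: pos_sign_def flip: power_mult_distrib)

lemma pos_sign_insert:
  assumes "finite J" "p \<notin> J"
  shows "pos_sign (insert p J) k = (if p < k then - 1 else 1) * pos_sign J k"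
proof -
  have "{j \<in> insert p J. j < k} = (if p < k then insert p {j \<in> J. j < k} else {j \<in> J. j < k})"
    by auto
  then show ?thesis using assms by (simp add: pos_sign_def)
qed

text \<open>Inserting \<open>p\<close> and removing \<open>k\<close> anticommute: exactly one of \<open>p < k\<close> and \<open>k < p\<close>
  holds, so exactly one of the two signs changes.\<close>

lemma pos_sign_exchange:
  assumes "finite J" "k \<in> J" "p \<notin> J"
  shows "pos_sign (insert p J) k * pos_sign J p =
      - (pos_sign J k * pos_sign (J - {k}) p :: 'a::comm_ring_1)"
proof -
  have "k \<noteq> p" using assms by auto
  have J: "J = insert k (J - {k})" using assms by auto
  have "pos_sign J p = (if k < p then - 1 else 1) * (pos_sign (J - {k}) p :: 'a)"
    using pos_sign_insert[of "J - {k}" k p, where 'a='a] assms J by simp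
  moreover have "pos_sign (insert p J) k = (if p < k then - 1 else 1) * (pos_sign J k :: 'a)"
    by (rule pos_sign_insert) (use assms in auto)
  ultimately show ?thesis using \<open>k \<noteq> p\<close> by (cases "k < p") auto
qed

text \<open>The Koszul differential in cohomological form, which raises the size of index sets.  It is defined on
  families over all index sets at once; the degree enters only through the sets at which a family is
  evaluated.\<close>

definition koszul_d :: "(nat \<Rightarrow> 'a) \<Rightarrow> (nat set \<Rightarrow> 'a) \<Rightarrow> nat set \<Rightarrow> 'a::comm_ring_1" where
  "koszul_d x c J = (\<Sum>k\<in>J. pos_sign J k * (x k * c (J - {k})))"

lemma koszul_d_add: "koszul_d x (\<lambda>L. b L + c L) J = koszul_d x b J + koszul_d x c J"
  by (simp add: koszul_d_def algebra_simps sum.distrib)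

lemma koszul_d_scale: "koszul_d x (\<lambda>L. a * c L) J = a * koszul_d x c J"
  by (simp add: koszul_d_def sum_distrib_left mult_ac)

lemma koszul_d_cong:
  "(\<And>k. k \<in> J \<Longrightarrow> b (J - {k}) = c (J - {k})) \<Longrightarrow> koszul_d x b J = koszul_d x c J"
  by (simp add: koszul_d_def cong: sum.cong)

lemma koszul_d_in_ideal:
  "(\<And>k. k \<in> J \<Longrightarrow> c (J - {k}) \<in> ring_module.span S) \<Longrightarrow> koszul_d x c J \<in> ring_module.span S"
  unfolding koszul_d_def by (intro ring_module.span_sum ideal_mult_left)

text \<open>The terms for \<open>(k, l)\<close> and \<open>(l, k)\<close> cancel.  Since 2 may be a zero divisor, antisymmetry of
  the summand is not enough by itself; the double sum is split into \<open>k < l\<close> and \<open>l < k\<close>.\<close>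

lemma koszul_d_koszul_d:
  assumes "finite J"
  shows "koszul_d x (koszul_d x c) J = (0 :: 'a::comm_ring_1)"
proof -
  define f :: "nat \<Rightarrow> nat \<Rightarrow> 'a" where "f k l = pos_sign J k * (x k * (pos_sign (J - {k}) l * (x l * c (J - {k} - {l}))))" for k l
  have anti: "f l k = - f k l" if "k \<in> J" "l \<in> J" "k \<noteq> l" for k l
  proof -
    define a b u v :: 'a where "a = pos_sign J k" and "b = pos_sign J l"
      and "u = pos_sign (J - {l}) k" and "v = pos_sign (J - {k}) l"
    have J: "insert l (J - {l}) = J" "insert l (J - {l} - {k}) = J - {k}" using that by auto
    have "pos_sign (J - {l}) l = b"
      using pos_sign_insert[of "J - {l}" l l, where 'a='a] assms J by (simp add: b_def)
    moreover have "pos_sign (J - {l} - {k}) l = v"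
      using pos_sign_insert[of "J - {l} - {k}" l l, where 'a='a] assms J by (simp add: v_def)
    ultimately have e: "a * b = - (u * v)"
      using pos_sign_exchange[of "J - {l}" k l, where 'a='a] assms that J by (simp add: a_def u_def)
    have sq: "b * b = 1" "v * v = 1" by (simp_all add: b_def v_def pos_sign_square)
    have "a * v = a * (b * b) * v" using sq by simp
    also have "\<dots> = (a * b) * (b * v)" by (simp only: mult_ac)
    also have "\<dots> = - (b * u * (v * v))" unfolding e by (simp add: mult_ac)
    finally have av: "a * v = - (b * u)" using sq by simp
    have L: "J - {l} - {k} = J - {k} - {l}" by auto
    let ?t = "x k * x l * c (J - {k} - {l})"
    have "f k l = (a * v) * ?t" by (simp add: f_def a_def v_def mult_ac)
    moreover have "f l k = (b * u) * ?t" by (simp add: f_def b_def u_def L mult_ac)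
    ultimately show ?thesis by (simp add: av)
  qed
  have "koszul_d x (koszul_d x c) J = (\<Sum>k\<in>J. \<Sum>l\<in>J - {k}. f k l)"
    by (simp add: koszul_d_def f_def sum_distrib_left)
  also have "\<dots> = (\<Sum>k\<in>J. (\<Sum>l | l \<in> J \<and> k < l. f k l) + (\<Sum>l | l \<in> J \<and> l < k. f k l))"
  proof (rule sum.cong[OF refl])
    fix k assume "k \<in> J"
    have "J - {k} = {l. l \<in> J \<and> k < l} \<union> {l. l \<in> J \<and> l < k}" by auto
    then show "(\<Sum>l\<in>J - {k}. f k l) = (\<Sum>l | l \<in> J \<and> k < l. f k l) + (\<Sum>l | l \<in> J \<and> l < k. f k l)"
      using assms by (simp add: sum.union_disjoint disjoint_iff)
  qed
  also have "\<dots> = (\<Sum>k\<in>J. \<Sum>l | l \<in> J \<and> k < l. f k l) + (\<Sum>k\<in>J. \<Sum>l | l \<in> J \<and> l < k. f k l)"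
    by (rule sum.distrib)
  also have "(\<Sum>k\<in>J. \<Sum>l | l \<in> J \<and> l < k. f k l) = (\<Sum>l\<in>J. \<Sum>k | k \<in> J \<and> l < k. f k l)"
    by (rule sum.swap_restrict) (use assms in auto)
  also have "\<dots> = (\<Sum>l\<in>J. \<Sum>k | k \<in> J \<and> l < k. - f l k)"
    by (intro sum.cong refl anti) auto
  finally show ?thesis by (simp add: sum_negf)
qed

text \<open>Contraction against the \<open>p\<close>-th basis vector: the homotopy that makes multiplication by
  \<open>x p\<close> null-homotopic on the Koszul complex.\<close>

definition contraction :: "nat \<Rightarrow> (nat set \<Rightarrow> 'a) \<Rightarrow> nat set \<Rightarrow> 'a::comm_ring_1" where
  "contraction p c J = (if p \<in> J then 0 else pos_sign J p * c (insert p J))"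

lemma koszul_contraction_homotopy:
  assumes "finite J"
  shows "koszul_d x (contraction p c) J + contraction p (koszul_d x c) J = (x p * c J :: 'a::comm_ring_1)"
proof (cases "p \<in> J")
  case True
  have "koszul_d x (contraction p c) J = (\<Sum>k\<in>{p}. pos_sign J k * (x k * contraction p c (J - {k})))"
    unfolding koszul_d_def
    by (rule sum.mono_neutral_right) (use assms True in \<open>auto simp: contraction_def\<close>)
  moreover have "pos_sign (J - {p}) p = (pos_sign J p :: 'a)"
    using pos_sign_insert[of "J - {p}" p p, where 'a='a] assms True by (simp add: insert_absorb)
  moreover have "pos_sign J p * (x p * (pos_sign J p * c J)) = x p * c J * (pos_sign J p * pos_sign J p)"
    by (simp add: mult_ac)
  ultimately show ?thesis using True
    by (simp add: contraction_def pos_sign_square insert_absorb)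
next
  case False
  have "contraction p (koszul_d x c) J
      = pos_sign J p * (pos_sign (insert p J) p * (x p * c J)) 
       + (\<Sum>k\<in>J. (pos_sign (insert p J) k * pos_sign J p) * (x k * c (insert p J - {k})))"
    using False assms by (simp add: contraction_def koszul_d_def distrib_left sum_distrib_left mult_ac)
  moreover have "(\<Sum>k\<in>J. (pos_sign (insert p J) k * pos_sign J p) * (x k * c (insert p J - {k})))
      = - koszul_d x (contraction p c) J"
    unfolding koszul_d_def sum_negf[symmetric]
  proof (rule sum.cong[OF refl])
    fix k assume k: "k \<in> J"
    then have "insert p J - {k} = insert p (J - {k})" using False by auto
    then show "(pos_sign (insert p J) k * pos_sign J p) * (x k * c (insert p J - {k}))
        = - (pos_sign J k * (x k * contraction p c (J - {k})))"
      using False unfolding pos_sign_exchange[OF assms k False]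
      by (simp add: contraction_def mult_ac)
  qed
  moreover have "pos_sign (insert p J) p = (pos_sign J p :: 'a)"
    using pos_sign_insert[of J p p, where 'a='a] assms False by simp
  ultimately show ?thesis by (simp add: pos_sign_square flip: mult.assoc)
qed

definition nonzerodivisor_mod :: "'a::comm_ring_1 set \<Rightarrow> 'a \<Rightarrow> bool" where
  "nonzerodivisor_mod S y \<longleftrightarrow> (\<forall>a. y * a \<in> ring_module.span S \<longrightarrow> a \<in> ring_module.span S)"

fun regular_seq :: "'a::comm_ring_1 set \<Rightarrow> 'a list \<Rightarrow> bool" where
  "regular_seq S [] \<longleftrightarrow> True"
| "regular_seq S (y # ys) \<longleftrightarrow> nonzerodivisor_mod S y \<and> regular_seq (insert y S) ys"

text \<open>Let \<open>y = x p\<close> be the first element of the regular sequence.  The contraction \<open>b\<close> of a cocycle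
  \<open>c\<close> satisfies \<open>d b = y c\<close> modulo \<open>S\<close>, so \<open>b\<close> is a cocycle one degree lower modulo
  \<open>S\<close> and \<open>y\<close>.  By induction \<open>b = d e + y b'\<close> modulo \<open>S\<close>, hence
  \<open>y c = y d b'\<close>, and \<open>y\<close> can be cancelled.\<close>

theorem koszul_vanishing:
  fixes x :: "nat \<Rightarrow> 'a::comm_ring_1"
  assumes "regular_seq S ys" "set ys \<subseteq> x ` {..<m}" "i < length ys"
    and "\<And>J. J \<subseteq> {..<m} \<Longrightarrow> card J = Suc i \<Longrightarrow> koszul_d x c J \<in> ring_module.span S"
  shows "\<exists>b. \<forall>J. J \<subseteq> {..<m} \<longrightarrow> card J = i \<longrightarrow> c J - koszul_d x b J \<in> ring_module.span S"
  using assms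
proof (induction ys arbitrary: S i c)
  case Nil
  then show ?case by simp
next
  case (Cons y ys)
  obtain p where p: "p < m" "y = x p" using Cons.prems(2) by auto
  define b where "b = contraction p c"
  have hom: "x p * c J - koszul_d x b J \<in> ring_module.span S" if J: "J \<subseteq> {..<m}" "card J = i" for J
  proof -
    have fin: "finite J" using J finite_subset by blast
    have "contraction p (koszul_d x c) J \<in> ring_module.span S"
    proof (cases "p \<in> J")
      case False
      then have "koszul_d x c (insert p J) \<in> ring_module.span S"
        using J p fin by (intro Cons.prems(4)) auto
      then show ?thesis using False by (simp add: contraction_def ring_module.span_scale)
    qed (simp add: contraction_def ring_module.span_zero)
    moreover have "x p * c J - koszul_d x b J = contraction p (koszul_d x c) J"
      using koszul_contraction_homotopy[OF fin, of x p c] by (simp add: b_def algebra_simps)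
    ultimately show ?thesis by simp
  qed
  have "\<exists>e. \<forall>L. L \<subseteq> {..<m} \<longrightarrow> Suc (card L) = i \<longrightarrow> b L - koszul_d x e L \<in> ring_module.span (insert y S)"
  proof (cases i)
    case (Suc i')
    have "koszul_d x b J \<in> ring_module.span (insert y S)" if "J \<subseteq> {..<m}" "card J = Suc i'" for J
      using ring_module.span_neg[OF hom[OF that(1)]] that Suc p
      by (auto simp: ring_module.span_breakdown_eq intro!: exI[of _ "c J"] simp: algebra_simps)
    then show ?thesis
      using Cons.IH[of "insert y S" i' b] Cons.prems Suc by auto
  qed simp
  then obtain e where e: "\<And>L. L \<subseteq> {..<m} \<Longrightarrow> Suc (card L) = i \<Longrightarrow> b L - koszul_d x e L \<in> ring_module.span (insert y S)"
    by blast
  then have "\<forall>L. \<exists>k. L \<subseteq> {..<m} \<longrightarrow> Suc (card L) = i \<longrightarrow> b L - koszul_d x e L - k * y \<in> ring_module.span S"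
    by (auto simp: ring_module.span_breakdown_eq)
  then obtain b' where b': "\<And>L. L \<subseteq> {..<m} \<Longrightarrow> Suc (card L) = i \<Longrightarrow>
      b L - koszul_d x e L - b' L * y \<in> ring_module.span S" by metis
  have "c J - koszul_d x b' J \<in> ring_module.span S" if J: "J \<subseteq> {..<m}" "card J = i" for J
  proof -
    have fin: "finite J" using J finite_subset by blast
    define s where "s L = b L - koszul_d x e L - b' L * y" for L
    have s: "koszul_d x s J \<in> ring_module.span S"
    proof (rule koszul_d_in_ideal)
      fix k assume "k \<in> J"
      then have "Suc (card (J - {k})) = i" using fin J by (metis card_Suc_Diff1)
      then show "s (J - {k}) \<in> ring_module.span S" unfolding s_def by (intro b') (use J in auto)
    qed
    have "koszul_d x b J = koszul_d x (\<lambda>L. s L + (koszul_d x e L + y * b' L)) J"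
      by (rule koszul_d_cong) (simp add: s_def algebra_simps)
    then have "koszul_d x b J = koszul_d x s J + y * koszul_d x b' J"
      by (simp add: koszul_d_add koszul_d_scale koszul_d_koszul_d[OF fin])
    then have "y * (c J - koszul_d x b' J) = (x p * c J - koszul_d x b J) + koszul_d x s J"
      using p by (simp add: algebra_simps)
    then have "y * (c J - koszul_d x b' J) \<in> ring_module.span S"
      using ring_module.span_add[OF hom[OF J] s] by simp
    then show ?thesis using Cons.prems(1) by (simp add: nonzerodivisor_mod_def)
  qed
  then show ?case by blast
qed

section \<open>The Koszul complex in homological form\<close>

definition koszul_bd :: "nat \<Rightarrow> (nat \<Rightarrow> 'a) \<Rightarrow> (nat set \<Rightarrow> 'a) \<Rightarrow> nat set \<Rightarrow> 'a::comm_ring_1" where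
  "koszul_bd m x c I = (\<Sum>k\<in>{..<m} - I. pos_sign I k * (x k * c (insert k I)))"

text \<open>The Koszul complex is self-dual: passing from index sets to their complements turns the boundary
  operator into the differential.  The two signs of an index \<open>k\<close>, relative to a set and to its
  complement, multiply to \<open>(- 1) ^ k\<close>, and this is what the sign below changes by when \<open>k\<close> is
  removed.\<close>

definition complement_sign :: "nat set \<Rightarrow> 'a::comm_ring_1" where
  "complement_sign J = (- 1) ^ (\<Sum>J)"

lemma complement_sign_square: "complement_sign J * complement_sign J = 1"
  by (simp add: complement_sign_def flip: power_mult_distrib)

lemma pos_sign_complement:
  assumes "I \<subseteq> {..<m}" "k < m"
  shows "pos_sign ({..<m} - I) k = (- 1) ^ k * (pos_sign I k :: 'a::comm_ring_1)"
proof -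
  let ?a = "card {j \<in> {..<m} - I. j < k}" and ?b = "card {j \<in> I. j < k}"
  have fin: "finite I" using assms finite_subset by blast
  have "{..<k} = {j \<in> {..<m} - I. j < k} \<union> {j \<in> I. j < k}" using assms by auto
  then have "card {..<k} = ?a + ?b"
    using fin by (metis (no_types, lifting) card_Un_disjoint[of "{j \<in> {..<m} - I. j < k}" "{j \<in> I. j < k}"] DiffD2 Int_emptyI finite_Diff finite_lessThan finite_subset mem_Collect_eq subsetI)
  then have "(- 1 :: 'a) ^ k = (- 1) ^ ?a * (- 1) ^ ?b"
    by (metis card_lessThan power_add)
  then have "(- 1 :: 'a) ^ k * (- 1) ^ ?b = (- 1) ^ ?a * ((- 1) ^ ?b * (- 1) ^ ?b)"
    by (simp only: mult.assoc)
  also have "(- 1 :: 'a) ^ ?b * (- 1) ^ ?b = 1" by (simp flip: power_mult_distrib)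
  finally show ?thesis by (simp add: pos_sign_def)
qed

lemma koszul_d_complement:
  assumes "I \<subseteq> {..<m}"
  shows "koszul_d x (\<lambda>J. complement_sign J * c ({..<m} - J)) ({..<m} - I)
       = complement_sign ({..<m} - I) * (koszul_bd m x c I :: 'a::comm_ring_1)"
  unfolding koszul_d_def koszul_bd_def sum_distrib_left
proof (rule sum.cong[OF refl])
  fix k assume k: "k \<in> {..<m} - I"
  let ?J = "{..<m} - I"
  have "\<Sum>?J = k + \<Sum>(?J - {k})" using k by (simp add: sum.remove)
  then have "complement_sign ?J = (- 1) ^ k * (complement_sign (?J - {k}) :: 'a)"
    by (simp add: complement_sign_def power_add)
  moreover have "{..<m} - (?J - {k}) = insert k I" using k assms by auto
  ultimately show "pos_sign ?J k * (x k * (complement_sign (?J - {k}) * c ({..<m} - (?J - {k}))))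
      = complement_sign ?J * (pos_sign I k * (x k * c (insert k I)))"
    using pos_sign_complement[OF assms, of k, where 'a='a] k by (simp add: mult_ac)
qed

lemma koszul_bd_cong:
  "(\<And>k. k \<in> {..<m} - I \<Longrightarrow> b (insert k I) = c (insert k I)) \<Longrightarrow> koszul_bd m x b I = koszul_bd m x c I"
  unfolding koszul_bd_def by (intro sum.cong refl) simp

lemma koszul_bd_koszul_bd:
  assumes "I \<subseteq> {..<m}"
  shows "koszul_bd m x (koszul_bd m x c) I = (0 :: 'a::comm_ring_1)"
proof -
  let ?J = "{..<m} - I" and ?c = "\<lambda>J. complement_sign J * c ({..<m} - J)"
  have "complement_sign ?J * koszul_bd m x (koszul_bd m x c) I
      = koszul_d x (\<lambda>J. complement_sign J * koszul_bd m x c ({..<m} - J)) ?J"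
    by (rule koszul_d_complement[OF assms, symmetric])
  also have "\<dots> = koszul_d x (koszul_d x ?c) ?J"
  proof (rule koszul_d_cong)
    fix k assume "k \<in> ?J"
    have "{..<m} - ({..<m} - (?J - {k})) = ?J - {k}" by auto
    then show "complement_sign (?J - {k}) * koszul_bd m x c ({..<m} - (?J - {k})) = koszul_d x ?c (?J - {k})"
      using koszul_d_complement[of "{..<m} - (?J - {k})" m x c] by simp
  qed
  also have "\<dots> = 0" by (rule koszul_d_koszul_d) simp
  finally have "complement_sign ?J * (complement_sign ?J * koszul_bd m x (koszul_bd m x c) I) = 0" by simp
  then show ?thesis by (simp add: complement_sign_square flip: mult.assoc)
qed

corollary koszul_homology_vanishing:
  fixes x :: "nat \<Rightarrow> 'a::comm_ring_1"
  assumes reg: "regular_seq {} (map x [0..<m])" and l: "0 < l"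
    and cyc: "\<And>I. I \<subseteq> {..<m} \<Longrightarrow> Suc (card I) = l \<Longrightarrow> koszul_bd m x c I = 0"
  shows "\<exists>b. \<forall>I. I \<subseteq> {..<m} \<longrightarrow> card I = l \<longrightarrow> c I = koszul_bd m x b I"
proof (cases "l \<le> m")
  case False
  then have "card I \<noteq> l" if "I \<subseteq> {..<m}" for I using card_mono[OF _ that] by auto
  then show ?thesis by blast
next
  case True
  have card: "card ({..<m} - J) = m - card J" if "J \<subseteq> {..<m}" for J
    using that by (simp add: card_Diff_subset finite_subset)
  have card_le: "card J \<le> m" if "J \<subseteq> {..<m}" for J using card_mono[OF _ that] by simp
  have dd: "{..<m} - ({..<m} - J) = J" if "J \<subseteq> {..<m}" for J using that by auto
  define c' where "c' J = complement_sign J * c ({..<m} - J)" for J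
  \<comment> \<open>homological degree \<open>l\<close> corresponds to cohomological degree \<open>m - l\<close>, which is below \<open>m\<close>\<close>
  have "koszul_d x c' J = 0" if J: "J \<subseteq> {..<m}" "card J = Suc (m - l)" for J
  proof -
    have "koszul_bd m x c ({..<m} - J) = 0"
      by (rule cyc) (use J card[OF J(1)] l True card_le[OF J(1)] in auto)
    then show ?thesis using koszul_d_complement[of "{..<m} - J" m x c] dd[OF J(1)]
      by (simp add: c'_def[abs_def])
  qed
  then have "\<exists>b. \<forall>J. J \<subseteq> {..<m} \<longrightarrow> card J = m - l \<longrightarrow> c' J - koszul_d x b J \<in> ring_module.span {}"
    by (intro koszul_vanishing[OF reg]) (use True l in \<open>auto simp: ring_module.span_zero\<close>)
  then obtain b where b: "\<And>J. J \<subseteq> {..<m} \<Longrightarrow> card J = m - l \<Longrightarrow> c' J = koszul_d x b J"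
    by auto
  define b' where "b' I = complement_sign ({..<m} - I) * b ({..<m} - I)" for I
  have "c I = koszul_bd m x b' I" if I: "I \<subseteq> {..<m}" "card I = l" for I
  proof -
    let ?J = "{..<m} - I"
    have "complement_sign ?J * koszul_bd m x b' I = koszul_d x (\<lambda>J. complement_sign J * b' ({..<m} - J)) ?J"
      by (rule koszul_d_complement[OF I(1), symmetric])
    also have "\<dots> = koszul_d x b ?J"
    proof (rule koszul_d_cong)
      fix k assume "k \<in> ?J"
      have "{..<m} - ({..<m} - (?J - {k})) = ?J - {k}" by auto
      then show "complement_sign (?J - {k}) * b' ({..<m} - (?J - {k})) = b (?J - {k})"
        by (simp add: b'_def complement_sign_square flip: mult.assoc)
    qed
    also have "\<dots> = c' ?J" using b[of ?J] I card[OF I(1)] by simp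
    also have "\<dots> = complement_sign ?J * c I" using dd[OF I(1)] by (simp add: c'_def)
    finally have "complement_sign ?J * (complement_sign ?J * koszul_bd m x b' I)
       = complement_sign ?J * (complement_sign ?J * c I)" by simp
    then show ?thesis by (simp add: complement_sign_square flip: mult.assoc)
  qed
  then show ?thesis by blast
qed

section \<open>Regular sequences\<close>

lemma regular_seq_append:
  "regular_seq S (xs @ ys) \<longleftrightarrow> regular_seq S xs \<and> regular_seq (set xs \<union> S) ys"
  by (induction xs arbitrary: S) auto

lemma regular_seqI:
  assumes "\<And>k. k < t \<Longrightarrow> nonzerodivisor_mod (F ` {..<k}) (F k)"
  shows "regular_seq {} (map F [0..<t])"
  using assms
proof (induction t)
  case (Suc t)
  then show ?case by (simp add: regular_seq_append lessThan_atLeast0)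
qed simp

text \<open>If \<open>y a = z b\<close> modulo \<open>T\<close>, then \<open>z b\<close> vanishes modulo \<open>y\<close>, so \<open>b\<close> is a multiple
  \<open>b' y\<close> of \<open>y\<close>; cancelling \<open>y\<close> leaves \<open>a = b' z\<close>.  This is how an element already known to be a
  nonzerodivisor survives the enlargement of the ideal by a later one.\<close>

lemma nonzerodivisor_mod_exchange:
  fixes y z :: "'a::comm_ring_1"
  assumes y: "nonzerodivisor_mod T y" and z: "nonzerodivisor_mod (insert y T) z"
  shows "nonzerodivisor_mod (insert z T) y"
  unfolding nonzerodivisor_mod_def
proof (intro allI impI)
  fix a assume "y * a \<in> ring_module.span (insert z T)"
  then obtain b where b: "y * a - b * z \<in> ring_module.span T"
    by (auto simp: ring_module.span_breakdown_eq)
  have "- (y * a - b * z) = z * b - a * y" by (simp add: algebra_simps)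
  then have "z * b - a * y \<in> ring_module.span T" using ring_module.span_neg[OF b] by metis
  then have "z * b \<in> ring_module.span (insert y T)"
    unfolding ring_module.span_breakdown_eq by blast
  then have "b \<in> ring_module.span (insert y T)" using z by (simp add: nonzerodivisor_mod_def)
  then obtain b' where b': "b - b' * y \<in> ring_module.span T"
    by (auto simp: ring_module.span_breakdown_eq)
  have "y * (a - b' * z) = (y * a - b * z) + z * (b - b' * y)" by (simp add: algebra_simps)
  then have "y * (a - b' * z) \<in> ring_module.span T"
    using ring_module.span_add[OF b ring_module.span_scale[OF b', of z]] by simp
  then show "a \<in> ring_module.span (insert z T)"
    using y by (auto simp: nonzerodivisor_mod_def ring_module.span_breakdown_eq)
qed

text \<open>The sequence \<open>g\<close> is regular in a strong sense: each member is a nonzerodivisor modulo any set of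
  other members.  This property is inherited by the members that remain after
  \<open>g 0, \<dots>, g (k - 1)\<close> have been replaced by \<open>F 0, \<dots>, F (k - 1)\<close>, and it is what makes the
  replacement of \<open>g k\<close> possible.\<close>

theorem regular_seq_deformation:
  fixes F g :: "nat \<Rightarrow> 'a::comm_ring_1"
  assumes base: "\<And>S i. S \<subseteq> {..<t} \<Longrightarrow> i < t \<Longrightarrow> i \<notin> S \<Longrightarrow> nonzerodivisor_mod (g ` S) (g i)"
    and deform: "\<And>k S. k < t \<Longrightarrow> S \<subseteq> {Suc k..<t} \<Longrightarrow>
        nonzerodivisor_mod (F ` {..<k} \<union> g ` S) (g k) \<Longrightarrow>
        nonzerodivisor_mod (F ` {..<k} \<union> g ` S) (F k)"
  shows "regular_seq {} (map F [0..<t])"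
proof -
  \<comment> \<open>the invariant after \<open>k\<close> replacements, for all sets \<open>S\<close> of later indices\<close>
  have *: "nonzerodivisor_mod (F ` {..<k} \<union> g ` S) (g i)"
    if "k \<le> t" "S \<subseteq> {k..<t}" "i \<in> {k..<t} - S" for k S i
    using that
  proof (induction k arbitrary: S i)
    case 0
    then show ?case using base[of S i] by (simp add: lessThan_atLeast0)
  next
    case (Suc k)
    let ?T = "F ` {..<k} \<union> g ` S"
    have "nonzerodivisor_mod ?T (g i)" by (rule Suc.IH) (use Suc.prems in auto)
    moreover have "nonzerodivisor_mod (F ` {..<k} \<union> g ` insert i S) (F k)"
    proof (rule deform)
      show "nonzerodivisor_mod (F ` {..<k} \<union> g ` insert i S) (g k)"
        by (rule Suc.IH) (use Suc.prems in auto)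
    qed (use Suc.prems in auto)
    ultimately have "nonzerodivisor_mod (insert (F k) ?T) (g i)"
      using nonzerodivisor_mod_exchange[of ?T "g i" "F k"] by simp
    then show ?case by (simp add: lessThan_Suc)
  qed
  show ?thesis
  proof (rule regular_seqI)
    fix k assume "k < t"
    then show "nonzerodivisor_mod (F ` {..<k}) (F k)"
      using deform[of k "{}"] *[of k "{}" k] by simp
  qed
qed

section \<open>Polynomials with polynomial coefficients\<close>

text \<open>A polynomial whose coefficients are polynomials is treated as one polynomial in both sets of
  variables: its terms are indexed by pairs of exponents.\<close>

definition monom2 :: "'a \<Rightarrow> 'b \<Rightarrow> 'k \<Rightarrow> 'a \<Rightarrow>\<^sub>0 'b \<Rightarrow>\<^sub>0 'k::zero" where
  "monom2 \<alpha> \<mu> c = Poly_Mapping.single \<alpha> (Poly_Mapping.single \<mu> c)"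

definition coeff2 :: "('a \<Rightarrow>\<^sub>0 'b \<Rightarrow>\<^sub>0 'k::zero) \<Rightarrow> 'a \<Rightarrow> 'b \<Rightarrow> 'k" where
  "coeff2 p \<alpha> \<mu> = Poly_Mapping.lookup (Poly_Mapping.lookup p \<alpha>) \<mu>"

lemma poly2_eqI: "(\<And>\<alpha> \<mu>. coeff2 p \<alpha> \<mu> = coeff2 q \<alpha> \<mu>) \<Longrightarrow> p = q"
  by (intro poly_mapping_eqI) (simp add: coeff2_def)

lemma coeff2_zero [simp]: "coeff2 0 \<alpha> \<mu> = 0"
  by (simp add: coeff2_def)

lemma coeff2_add: "coeff2 (p + q) \<alpha> \<mu> = coeff2 p \<alpha> \<mu> + coeff2 q \<alpha> \<mu>"
  by (simp add: coeff2_def lookup_add)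

lemma coeff2_sum: "coeff2 (sum f A) \<alpha> \<mu> = (\<Sum>x\<in>A. coeff2 (f x) \<alpha> \<mu>)"
  by (simp add: coeff2_def lookup_sum)

lemma coeff2_monom2: "coeff2 (monom2 \<beta> \<nu> c) \<alpha> \<mu> = (if \<alpha> = \<beta> \<and> \<mu> = \<nu> then c else 0)"
  by (auto simp: coeff2_def monom2_def lookup_single when_def)

lemma monom2_mult: "monom2 \<alpha> \<mu> c * monom2 \<beta> \<nu> d = monom2 (\<alpha> + \<beta>) (\<mu> + \<nu>) (c * d)"
  by (simp add: monom2_def mult_single)

lemma monom2_zero [simp]: "monom2 \<alpha> \<mu> 0 = 0"
  by (simp add: monom2_def)

definition support2 :: "('a \<Rightarrow>\<^sub>0 'b \<Rightarrow>\<^sub>0 'k::zero) \<Rightarrow> ('a \<times> 'b) set" where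
  "support2 p = {(\<alpha>, \<mu>). coeff2 p \<alpha> \<mu> \<noteq> 0}"

lemma support2_eq_Sigma:
  "support2 p = (SIGMA \<alpha>:Poly_Mapping.keys p. Poly_Mapping.keys (Poly_Mapping.lookup p \<alpha>))"
  by (auto simp: support2_def coeff2_def in_keys_iff)

lemma finite_support2 [simp]: "finite (support2 p)"
  by (simp add: support2_eq_Sigma)

lemma poly2_expansion: "p = (\<Sum>(\<alpha>, \<mu>)\<in>support2 p. monom2 \<alpha> \<mu> (coeff2 p \<alpha> \<mu>))"
proof (rule poly2_eqI)
  fix \<alpha> \<mu>
  have "coeff2 (\<Sum>(\<alpha>, \<mu>)\<in>support2 p. monom2 \<alpha> \<mu> (coeff2 p \<alpha> \<mu>)) \<alpha> \<mu>
     = (\<Sum>z\<in>support2 p. if z = (\<alpha>, \<mu>) then coeff2 p \<alpha> \<mu> else 0)"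
    unfolding coeff2_sum by (rule sum.cong) (auto simp: coeff2_monom2 split: if_splits)
  also have "\<dots> = coeff2 p \<alpha> \<mu>" by (simp, simp add: support2_def)
  finally show "coeff2 p \<alpha> \<mu> = coeff2 (\<Sum>(\<alpha>, \<mu>)\<in>support2 p. monom2 \<alpha> \<mu> (coeff2 p \<alpha> \<mu>)) \<alpha> \<mu>" ..
qed

lemma poly2_induct [case_names monom add]:
  fixes p :: "'a \<Rightarrow>\<^sub>0 'b \<Rightarrow>\<^sub>0 'k::comm_monoid_add"
  assumes "\<And>\<alpha> \<mu> c. P (monom2 \<alpha> \<mu> c)" and add: "\<And>p q. P p \<Longrightarrow> P q \<Longrightarrow> P (p + q)"
  shows "P p"
proof -
  have "P (\<Sum>(\<alpha>, \<mu>)\<in>A. monom2 \<alpha> \<mu> (coeff2 p \<alpha> \<mu>))" if "finite A" for A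
    using that
  proof (induction A)
    case empty
    show ?case using assms(1)[of _ _ 0] by simp
  qed (auto intro!: assms)
  from this[OF finite_support2[of p]] show ?thesis unfolding poly2_expansion[of p, symmetric] .
qed

text \<open>Discarding all terms outside a set of exponent pairs is additive, and it commutes with
  multiplication by \<open>q\<close> when membership in the set is not affected by the exponents of \<open>q\<close>
  (\<open>filter2_mult\<close>).  Three such operators are used below: reduction modulo a monomial ideal, the
  homogeneous components in one variable, and the projection onto fewer variables.\<close>

definition filter2 :: "('a \<Rightarrow> 'b \<Rightarrow> bool) \<Rightarrow> ('a \<Rightarrow>\<^sub>0 'b \<Rightarrow>\<^sub>0 'k::zero) \<Rightarrow> 'a \<Rightarrow>\<^sub>0 'b \<Rightarrow>\<^sub>0 'k" where
  "filter2 P p = Poly_Mapping.mapp (\<lambda>\<alpha>. Poly_Mapping.mapp (\<lambda>\<mu> c. c when P \<alpha> \<mu>)) p"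

lemma coeff2_filter2: "coeff2 (filter2 P p) \<alpha> \<mu> = (if P \<alpha> \<mu> then coeff2 p \<alpha> \<mu> else 0)"
  by (auto simp: coeff2_def filter2_def lookup_mapp when_def in_keys_iff)

lemma filter2_add: "filter2 P (p + q) = filter2 P p + filter2 P q"
  by (rule poly2_eqI) (simp add: coeff2_filter2 coeff2_add)

lemma filter2_zero [simp]: "filter2 P 0 = 0"
  by (rule poly2_eqI) (simp add: coeff2_filter2)

lemma filter2_sum: "filter2 P (sum f A) = (\<Sum>x\<in>A. filter2 P (f x))"
  by (rule poly2_eqI) (simp add: coeff2_filter2 coeff2_sum)

lemma filter2_monom2: "filter2 P (monom2 \<alpha> \<mu> c) = (if P \<alpha> \<mu> then monom2 \<alpha> \<mu> c else 0)"
  by (rule poly2_eqI) (auto simp: coeff2_filter2 coeff2_monom2)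

lemma filter2_eq_self: "(\<And>\<alpha> \<mu>. coeff2 p \<alpha> \<mu> \<noteq> 0 \<Longrightarrow> P \<alpha> \<mu>) \<Longrightarrow> filter2 P p = p"
  by (rule poly2_eqI) (auto simp: coeff2_filter2)

lemma filter2_split: "p = filter2 P p + filter2 (\<lambda>\<alpha> \<mu>. \<not> P \<alpha> \<mu>) (p :: 'a \<Rightarrow>\<^sub>0 'b \<Rightarrow>\<^sub>0 'k::comm_monoid_add)"
  by (rule poly2_eqI) (simp add: coeff2_filter2 coeff2_add)

lemma filter2_mult:
  fixes p q :: "'a::comm_monoid_add \<Rightarrow>\<^sub>0 'b::comm_monoid_add \<Rightarrow>\<^sub>0 'k::comm_ring_1"
  assumes "\<And>\<beta> \<nu> \<alpha> \<mu>. coeff2 q \<beta> \<nu> \<noteq> 0 \<Longrightarrow> P (\<beta> + \<alpha>) (\<nu> + \<mu>) \<longleftrightarrow> Q \<alpha> \<mu>"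
  shows "filter2 P (q * p) = q * filter2 Q p"
proof -
  have mono: "filter2 P (monom2 \<beta> \<nu> c * p) = monom2 \<beta> \<nu> c * filter2 Q p" if "coeff2 q \<beta> \<nu> \<noteq> 0" for \<beta> \<nu> c
    by (induction p rule: poly2_induct)
      (simp_all add: monom2_mult filter2_monom2 assms[OF that] distrib_left filter2_add)
  let ?q = "\<Sum>(\<beta>, \<nu>)\<in>support2 q. monom2 \<beta> \<nu> (coeff2 q \<beta> \<nu>)"
  have "filter2 P (?q * p) = ?q * filter2 Q p"
    unfolding sum_distrib_right filter2_sum
    by (rule sum.cong) (auto simp: mono support2_def)
  then show ?thesis unfolding poly2_expansion[of q, symmetric] .
qed

lemma coeff2_monom2_mult:
  fixes p :: "'a::cancel_comm_monoid_add \<Rightarrow>\<^sub>0 'b::cancel_comm_monoid_add \<Rightarrow>\<^sub>0 'k::comm_ring_1"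
  shows "coeff2 (monom2 \<beta> \<nu> c * p) (\<beta> + \<alpha>) (\<nu> + \<mu>) = c * coeff2 p \<alpha> \<mu>"
  by (induction p rule: poly2_induct) (simp_all add: monom2_mult coeff2_monom2 distrib_left coeff2_add)

section \<open>Ideals generated by monomials\<close>

type_synonym ('v, 'w, 'k) bipoly = "('v \<Rightarrow>\<^sub>0 nat) \<Rightarrow>\<^sub>0 ('w \<Rightarrow>\<^sub>0 nat) \<Rightarrow>\<^sub>0 'k"

definition divides_expo :: "('v \<Rightarrow>\<^sub>0 nat) \<Rightarrow> ('v \<Rightarrow>\<^sub>0 nat) \<Rightarrow> bool" where
  "divides_expo \<beta> \<alpha> \<longleftrightarrow> (\<forall>v. Poly_Mapping.lookup \<beta> v \<le> Poly_Mapping.lookup \<alpha> v)"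

lemma divides_expo_iff: "divides_expo \<beta> \<alpha> \<longleftrightarrow> (\<exists>\<gamma>. \<alpha> = \<beta> + \<gamma>)"
proof
  assume "divides_expo \<beta> \<alpha>"
  then have "\<alpha> = \<beta> + (\<alpha> - \<beta>)"
    by (intro poly_mapping_eqI) (simp add: lookup_add lookup_minus divides_expo_def)
  then show "\<exists>\<gamma>. \<alpha> = \<beta> + \<gamma>" ..
qed (auto simp: divides_expo_def lookup_add)

lemma divides_expo_add_coprime:
  assumes "Poly_Mapping.keys \<beta> \<inter> Poly_Mapping.keys \<gamma> = {}"
  shows "divides_expo \<beta> (\<gamma> + \<alpha>) \<longleftrightarrow> divides_expo \<beta> \<alpha>"
proof -
  have "Poly_Mapping.lookup \<beta> v \<le> Poly_Mapping.lookup (\<gamma> + \<alpha>) v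
      \<longleftrightarrow> Poly_Mapping.lookup \<beta> v \<le> Poly_Mapping.lookup \<alpha> v" for v
    using assms by (cases "Poly_Mapping.lookup \<beta> v = 0") (auto simp: lookup_add disjoint_iff in_keys_iff)
  then show ?thesis by (simp add: divides_expo_def)
qed

definition divisible2 :: "(('v \<Rightarrow>\<^sub>0 nat) \<times> ('w \<Rightarrow>\<^sub>0 nat)) set \<Rightarrow> ('v \<Rightarrow>\<^sub>0 nat) \<Rightarrow> ('w \<Rightarrow>\<^sub>0 nat) \<Rightarrow> bool" where
  "divisible2 G \<alpha> \<mu> \<longleftrightarrow> (\<exists>(\<beta>, \<nu>)\<in>G. divides_expo \<beta> \<alpha> \<and> divides_expo \<nu> \<mu>)"

text \<open>The operator that discards the multiples of the generators vanishes on the ideal, and an element that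
  it kills is a sum of multiples of the generators.\<close>

lemma in_monomial_ideal_iff:
  fixes a :: "('v, 'w, 'k::comm_ring_1) bipoly"
  shows "a \<in> ring_module.span ((\<lambda>(\<beta>, \<nu>). monom2 \<beta> \<nu> 1) ` G)
     \<longleftrightarrow> filter2 (\<lambda>\<alpha> \<mu>. \<not> divisible2 G \<alpha> \<mu>) a = 0" (is "a \<in> ?I \<longleftrightarrow> ?f a = 0")
proof
  assume "a \<in> ?I"
  then show "?f a = 0"
  proof (induction rule: ring_module.span_induct_alt)
    case (step c x y)
    then obtain \<beta> \<nu> where x: "x = monom2 \<beta> \<nu> 1" "(\<beta>, \<nu>) \<in> G" by auto
    have "?f (x * c) = x * filter2 (\<lambda>_ _. False) c"
    proof (rule filter2_mult)
      fix \<beta>' \<nu>' \<alpha> \<mu> assume "coeff2 x \<beta>' \<nu>' \<noteq> 0"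
      then have "\<beta>' = \<beta>" "\<nu>' = \<nu>" by (auto simp: x coeff2_monom2 split: if_splits)
      then show "\<not> divisible2 G (\<beta>' + \<alpha>) (\<nu>' + \<mu>) \<longleftrightarrow> False"
        using x(2) by (auto simp: divisible2_def divides_expo_iff intro!: bexI[of _ "(\<beta>, \<nu>)"])
    qed
    moreover have "filter2 (\<lambda>_ _. False) c = 0" by (rule poly2_eqI) (simp add: coeff2_filter2)
    ultimately show ?case using step by (simp add: filter2_add mult.commute)
  qed simp
next
  assume "?f a = 0"
  then have a: "a = filter2 (divisible2 G) a" using filter2_split[of a "divisible2 G"] by simp
  have "filter2 (divisible2 G) b \<in> ?I" for b :: "('v, 'w, 'k) bipoly"
  proof (induction b rule: poly2_induct)
    case (monom \<alpha> \<mu> c)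
    show ?case
    proof (cases "divisible2 G \<alpha> \<mu>")
      case True
      then obtain \<beta> \<nu> \<alpha>' \<mu>' where "(\<beta>, \<nu>) \<in> G" "\<alpha> = \<beta> + \<alpha>'" "\<mu> = \<nu> + \<mu>'"
        by (auto simp: divisible2_def divides_expo_iff)
      then have "monom2 \<alpha> \<mu> c = monom2 \<alpha>' \<mu>' c * monom2 \<beta> \<nu> 1" "monom2 \<beta> \<nu> 1 \<in> (\<lambda>(\<beta>, \<nu>). monom2 \<beta> \<nu> (1::'k)) ` G"
        by (auto simp: monom2_mult add.commute)
      then have "monom2 \<alpha> \<mu> c \<in> ?I" by (metis ring_module.span_scale ring_module.span_base)
      then show ?thesis using True by (simp add: filter2_monom2)
    qed (simp add: filter2_monom2 ring_module.span_zero)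
  qed (simp add: filter2_add ring_module.span_add)
  then show "a \<in> ?I" by (subst a)
qed

text \<open>Divisibility of a monomial by a generator is unchanged when it is multiplied by a monomial coprime to
  that generator.  Hence reduction modulo the ideal commutes with multiplication by such a monomial,
  and multiplication by a monomial is injective.\<close>

theorem coprime_monomials_nonzerodivisor:
  fixes \<beta> :: "'v \<Rightarrow>\<^sub>0 nat" and \<nu> :: "'w \<Rightarrow>\<^sub>0 nat"
  assumes "\<And>\<beta>' \<nu>'. (\<beta>', \<nu>') \<in> G \<Longrightarrow> Poly_Mapping.keys \<beta>' \<inter> Poly_Mapping.keys \<beta> = {}"
    and "\<And>\<beta>' \<nu>'. (\<beta>', \<nu>') \<in> G \<Longrightarrow> Poly_Mapping.keys \<nu>' \<inter> Poly_Mapping.keys \<nu> = {}"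
  shows "nonzerodivisor_mod ((\<lambda>(\<beta>, \<nu>). monom2 \<beta> \<nu> (1::'k::comm_ring_1)) ` G) (monom2 \<beta> \<nu> 1)"
  unfolding nonzerodivisor_mod_def in_monomial_ideal_iff
proof (intro allI impI)
  fix a :: "('v, 'w, 'k) bipoly"
  let ?f = "filter2 (\<lambda>\<alpha> \<mu>. \<not> divisible2 G \<alpha> \<mu>)"
  have inv: "divisible2 G (\<beta> + \<alpha>) (\<nu> + \<mu>) \<longleftrightarrow> divisible2 G \<alpha> \<mu>" for \<alpha> \<mu>
    unfolding divisible2_def
    by (intro bex_cong refl) (use assms in \<open>auto simp: divides_expo_add_coprime\<close>)
  have "?f (monom2 \<beta> \<nu> 1 * a) = monom2 \<beta> \<nu> 1 * ?f a"
    by (rule filter2_mult) (auto simp: coeff2_monom2 inv split: if_splits)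
  moreover assume "?f (monom2 \<beta> \<nu> 1 * a) = 0"
  ultimately have "monom2 \<beta> \<nu> 1 * ?f a = 0" by simp
  then have "coeff2 (?f a) \<alpha> \<mu> = 0" for \<alpha> \<mu>
    using coeff2_monom2_mult[of \<beta> \<nu> 1 "?f a" \<alpha> \<mu>] by simp
  then show "?f a = 0" by (intro poly2_eqI) simp
qed

section \<open>Deforming by terms free of a variable\<close>

definition homogeneous_in :: "'w \<Rightarrow> nat \<Rightarrow> ('v, 'w, 'k::zero) bipoly \<Rightarrow> bool" where
  "homogeneous_in v e p \<longleftrightarrow> (\<forall>\<alpha> \<mu>. coeff2 p \<alpha> \<mu> \<noteq> 0 \<longrightarrow> Poly_Mapping.lookup \<mu> v = e)"

definition component_in :: "'w \<Rightarrow> nat \<Rightarrow> ('v, 'w, 'k::zero) bipoly \<Rightarrow> ('v, 'w, 'k) bipoly" where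
  "component_in v e = filter2 (\<lambda>\<alpha> \<mu>. Poly_Mapping.lookup \<mu> v = e)"

lemma component_in_mult:
  fixes p q :: "('v, 'w, 'k::comm_ring_1) bipoly"
  assumes "homogeneous_in v e q"
  shows "component_in v (e + e') (q * p) = q * component_in v e' p"
  unfolding component_in_def
  by (rule filter2_mult) (use assms in \<open>auto simp: homogeneous_in_def lookup_add\<close>)

lemma component_in_ideal:
  fixes a :: "('v, 'w, 'k::comm_ring_1) bipoly"
  assumes T: "\<And>x. x \<in> T \<Longrightarrow> homogeneous_in v 0 x" and "a \<in> ring_module.span T"
  shows "component_in v e a \<in> ring_module.span T"
  using assms(2)
proof (induction rule: ring_module.span_induct_alt)
  case base
  then show ?case by (simp add: component_in_def ring_module.span_zero)
next
  case (step c x y)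
  have "component_in v e (c * x + y) = component_in v e c * x + component_in v e y"
    using component_in_mult[OF T[OF step(1)], of e c] by (simp add: component_in_def filter2_add mult.commute)
  then show ?case using step by (simp add: ring_module.span_add ring_module.span_scale ring_module.span_base)
qed

text \<open>Suppose that \<open>(g + h) a\<close> lies in the ideal.  The ideal contains the components of its members in the
  variable \<open>v\<close>, since its generators are free of \<open>v\<close>.  The component of degree \<open>e + 1\<close> is
  \<open>g a\<^sub>e + h a\<^bsub>e+1\<^esub>\<close>, so descending induction on \<open>e\<close> puts every \<open>g a\<^sub>e\<close>, and
  with it every \<open>a\<^sub>e\<close>, into the ideal.\<close>

theorem nonzerodivisor_mod_deform:
  fixes g h :: "('v, 'w, 'k::comm_ring_1) bipoly"
  assumes T: "\<And>x. x \<in> T \<Longrightarrow> homogeneous_in v 0 x"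
    and g: "homogeneous_in v 1 g" and h: "homogeneous_in v 0 h"
    and nzd: "nonzerodivisor_mod T g"
  shows "nonzerodivisor_mod T (g + h)"
  unfolding nonzerodivisor_mod_def
proof (intro allI impI)
  fix a assume a: "(g + h) * a \<in> ring_module.span T"
  define N where "N = Max (insert 0 ((\<lambda>(\<alpha>, \<mu>). Poly_Mapping.lookup \<mu> v) ` support2 a))"
  have N: "Poly_Mapping.lookup \<mu> v \<le> N" if "coeff2 a \<alpha> \<mu> \<noteq> 0" for \<alpha> \<mu>
    unfolding N_def
  proof (rule Max_ge)
    show "Poly_Mapping.lookup \<mu> v \<in> insert 0 ((\<lambda>(\<alpha>, \<mu>). Poly_Mapping.lookup \<mu> v) ` support2 a)"
      using that by (auto simp: support2_def intro!: image_eqI[of _ _ "(\<alpha>, \<mu>)"])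
  qed simp
  \<comment> \<open>Descending induction on the degree, written as ascending induction on \<open>k\<close>; truncated
    subtraction makes it stop at degree 0.\<close>
  have comp: "component_in v (Suc N - k) a \<in> ring_module.span T" for k
  proof (induction k)
    case 0
    have "component_in v (Suc N) a = 0"
      by (rule poly2_eqI) (use N in \<open>fastforce simp: component_in_def coeff2_filter2\<close>)
    then show ?case by (simp add: ring_module.span_zero)
  next
    case (Suc k)
    show ?case
    proof (cases "k \<le> N")
      case True
      let ?e = "Suc N - Suc k"
      have e: "Suc N - k = Suc ?e" using True by simp
      have "component_in v (Suc ?e) ((g + h) * a) = g * component_in v ?e a + h * component_in v (Suc ?e) a"
        using component_in_mult[OF g, of ?e a] component_in_mult[OF h, of "Suc ?e" a]
        by (simp add: distrib_right component_in_def filter2_add)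
      then have "g * component_in v ?e a = component_in v (Suc ?e) ((g + h) * a) - h * component_in v (Suc ?e) a"
        by simp
      also have "\<dots> \<in> ring_module.span T"
        by (rule ring_module.span_diff[OF component_in_ideal[OF T a] ideal_mult_left[OF Suc.IH[unfolded e]]])
      finally show ?thesis using nzd by (simp add: nonzerodivisor_mod_def)
    next
      case False
      then have "Suc N - Suc k = Suc N - k" by simp
      then show ?thesis using Suc.IH by metis
    qed
  qed
  have "a = (\<Sum>e\<le>N. component_in v e a)"
  proof (rule poly2_eqI)
    fix \<alpha> \<mu>
    show "coeff2 a \<alpha> \<mu> = coeff2 (\<Sum>e\<le>N. component_in v e a) \<alpha> \<mu>"
      using N[of \<alpha> \<mu>] by (cases "coeff2 a \<alpha> \<mu> = 0") (auto simp: coeff2_sum component_in_def coeff2_filter2)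
  qed
  also have "\<dots> \<in> ring_module.span T"
  proof (rule ring_module.span_sum)
    fix e assume "e \<in> {..N}"
    then show "component_in v e a \<in> ring_module.span T" using comp[of "Suc N - e"] by simp
  qed
  finally show "a \<in> ring_module.span T" .
qed

section \<open>The generic polynomials form a regular sequence\<close>

text \<open>The exponent of the product of the \<open>e j\<close>-th powers of \<open>X\<^bsub>j,k\<^esub>\<close> over all packets \<open>j\<close>.\<close>

definition diag_expo :: "nat \<Rightarrow> nat \<Rightarrow> (nat \<Rightarrow> nat) \<Rightarrow> expo" where
  "diag_expo s k e = (\<Sum>j = 1..s. Poly_Mapping.single (j, k) (e j))"

lemma lookup_diag_expo:
  "Poly_Mapping.lookup (diag_expo s k e) (j, k') = (if j \<in> {1..s} \<and> k' = k then e j else 0)"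
proof -
  have "Poly_Mapping.lookup (diag_expo s k e) (j, k') = (\<Sum>i = 1..s. if i = j then (if k' = k then e j else 0) else 0)"
    unfolding diag_expo_def lookup_sum by (rule sum.cong) (auto simp: lookup_single when_def)
  then show ?thesis by simp
qed

lemma keys_diag_expo: "Poly_Mapping.keys (diag_expo s k e) \<subseteq> {1..s} \<times> {k}"
  by (auto simp: in_keys_iff lookup_diag_expo split: if_splits)

lemma keys_diag_expo_disjoint:
  "k \<noteq> k' \<Longrightarrow> Poly_Mapping.keys (diag_expo s k e) \<inter> Poly_Mapping.keys (diag_expo s k' e') = {}"
  using keys_diag_expo[of s k e] keys_diag_expo[of s k' e'] by blast

lemma diag_expo_in_expos:
  assumes "\<And>j. j \<in> {1..s} \<Longrightarrow> k \<in> {1..n j + 1}"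
  shows "diag_expo s k e \<in> expos s n e"
proof -
  have "Poly_Mapping.keys (diag_expo s k e) \<subseteq> X_vars s n"
    using keys_diag_expo[of s k e] assms by (fastforce simp: X_vars_def)
  moreover have "(\<Sum>k' = 1..n j + 1. Poly_Mapping.lookup (diag_expo s k e) (j, k')) = e j" if "j \<in> {1..s}" for j
    using assms[OF that] that by (simp add: lookup_diag_expo)
  ultimately show ?thesis by (simp add: expos_def)
qed

definition diag_monom :: "nat \<Rightarrow> nat \<Rightarrow> nat \<Rightarrow> 'k::idom gen_poly" where
  "diag_monom s N k = monom2 (diag_expo s k (\<lambda>_. N)) 0 1"

definition lead_monom :: "nat \<Rightarrow> (nat \<Rightarrow> nat \<Rightarrow> nat) \<Rightarrow> nat \<Rightarrow> 'k::idom gen_poly" where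
  "lead_monom s d i = monom2 (diag_expo s i (d i)) (Poly_Mapping.single (i, diag_expo s i (d i)) 1) 1"

lemma homogeneous_in_generic_sum:
  assumes "\<And>\<alpha>. \<alpha> \<in> A \<Longrightarrow> (i, \<alpha>) \<noteq> v"
  shows "homogeneous_in v 0 (\<Sum>\<alpha>\<in>A. Poly_Mapping.single \<alpha> (var_U i \<alpha>) :: 'k::idom gen_poly)"
  unfolding homogeneous_in_def
proof (intro allI impI)
  fix \<alpha> \<mu> assume "coeff2 (\<Sum>\<alpha>\<in>A. Poly_Mapping.single \<alpha> (var_U i \<alpha>) :: 'k gen_poly) \<alpha> \<mu> \<noteq> 0"
  then obtain \<beta> where "\<beta> \<in> A" "coeff2 (monom2 \<beta> (Poly_Mapping.single (i, \<beta>) 1) 1 :: 'k gen_poly) \<alpha> \<mu> \<noteq> 0"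
    unfolding coeff2_sum var_U_def monom2_def by (meson sum.not_neutral_contains_not_neutral)
  then show "Poly_Mapping.lookup \<mu> v = 0"
    using assms[of \<beta>] by (auto simp: coeff2_monom2 lookup_single when_def split: if_splits)
qed

lemma generic_poly_split:
  assumes "\<And>j. j \<in> {1..s} \<Longrightarrow> i \<in> {1..n j + 1}"
  shows "generic_poly s n d i = lead_monom s d i
     + (\<Sum>\<alpha>\<in>expos s n (d i) - {diag_expo s i (d i)}. Poly_Mapping.single \<alpha> (var_U i \<alpha>) :: 'k::idom gen_poly)"
proof -
  have "diag_expo s i (d i) \<in> expos s n (d i)"
    by (rule diag_expo_in_expos) (rule assms)
  from sum.remove[OF finite_expos this] show ?thesis
    unfolding generic_poly_def lead_monom_def monom2_def by (simp add: var_U_def)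
qed

text \<open>Each generic polynomial is deformed from its leading term along the coefficient variable of that
  term, while the monomials at the end of the list stay as they are.  For \<open>N = 0\<close> these monomials
  are 1, a nonzerodivisor modulo every ideal, so this exponent is no exception.\<close>

theorem regular_seq_generic_polys_monomials:
  assumes n: "\<And>j. j \<in> {1..s} \<Longrightarrow> n 1 \<le> n j" and r: "r \<le> n 1 + 1"
  shows "regular_seq {} (generic_polys s n r d @ map (diag_monom s N) [r + 1..<n 1 + 2] :: 'k::idom gen_poly list)"
proof -
  define t where "t = n 1 + 1"
  define \<beta> where "\<beta> k = diag_expo s (Suc k) (if k < r then d (Suc k) else (\<lambda>_. N))" for k
  define \<nu> :: "nat \<Rightarrow> (nat \<times> expo) \<Rightarrow>\<^sub>0 nat" where
    "\<nu> k = (if k < r then Poly_Mapping.single (Suc k, \<beta> k) 1 else 0)" for k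
  define g :: "nat \<Rightarrow> 'k gen_poly" where "g k = monom2 (\<beta> k) (\<nu> k) 1" for k
  define F :: "nat \<Rightarrow> 'k gen_poly" where
    "F k = (if k < r then generic_poly s n d (Suc k) else diag_monom s N (Suc k))" for k
  \<comment> \<open>The sequence is indexed from 0, so the member \<open>F k\<close> belongs to the polynomial or monomial
    with number \<open>k + 1\<close>.\<close>
  have "regular_seq {} (map F [0..<t])"
  proof (rule regular_seq_deformation)
    fix S i assume "S \<subseteq> {..<t}" "i < t" "i \<notin> S"
    have g: "g ` S = (\<lambda>(\<beta>, \<nu>). monom2 \<beta> \<nu> 1) ` (\<lambda>k. (\<beta> k, \<nu> k)) ` S"
      by (simp add: g_def image_image)
    have "nonzerodivisor_mod (g ` S) (monom2 (\<beta> i) (\<nu> i) 1)"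
      unfolding g
    proof (rule coprime_monomials_nonzerodivisor)
      fix \<beta>' \<nu>' assume "(\<beta>', \<nu>') \<in> (\<lambda>k. (\<beta> k, \<nu> k)) ` S"
      then obtain k where "k \<in> S" and k': "\<beta>' = \<beta> k" "\<nu>' = \<nu> k" by auto
      then have k: "k \<noteq> i" using \<open>i \<notin> S\<close> by auto
      show "Poly_Mapping.keys \<beta>' \<inter> Poly_Mapping.keys (\<beta> i) = {}"
        unfolding k'(1) \<beta>_def using k by (intro keys_diag_expo_disjoint) simp
      show "Poly_Mapping.keys \<nu>' \<inter> Poly_Mapping.keys (\<nu> i) = {}"
        unfolding k'(2) \<nu>_def using k by simp
    qed
    then show "nonzerodivisor_mod (g ` S) (g i)" by (simp only: g_def)
  next
    fix k S assume k: "k < t" "S \<subseteq> {Suc k..<t}"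
      and nzd: "nonzerodivisor_mod (F ` {..<k} \<union> g ` S) (g k)"
    show "nonzerodivisor_mod (F ` {..<k} \<union> g ` S) (F k)"
    proof (cases "k < r")
      case True
      \<comment> \<open>the coefficient variable of the leading term, which occurs in no other member of the sequence\<close>
      let ?v = "(Suc k, \<beta> k)"
      have F: "F k = g k + (\<Sum>\<alpha>\<in>expos s n (d (Suc k)) - {\<beta> k}. Poly_Mapping.single \<alpha> (var_U (Suc k) \<alpha>))"
        using generic_poly_split[of s "Suc k" n d, where 'k='k] n k(1) True
        by (force simp: F_def g_def \<nu>_def \<beta>_def lead_monom_def t_def)
      show ?thesis unfolding F
      proof (rule nonzerodivisor_mod_deform[where v = ?v, OF _ _ _ nzd])
        fix x assume "x \<in> F ` {..<k} \<union> g ` S"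
        then show "homogeneous_in ?v 0 x"
        proof
          assume "x \<in> F ` {..<k}"
          then obtain i where "i < k" "x = F i" by auto
          then show ?thesis using True
            by (simp add: F_def generic_poly_def homogeneous_in_generic_sum)
        next
          assume "x \<in> g ` S"
          then obtain i where "i \<in> S" "x = g i" by auto
          then have "i > k" "x = g i" using k by auto
          then show ?thesis
            by (auto simp: g_def \<nu>_def homogeneous_in_def coeff2_monom2 lookup_single when_def split: if_splits)
        qed
      next
        show "homogeneous_in ?v 1 (g k)"
          using True by (auto simp: g_def \<nu>_def homogeneous_in_def coeff2_monom2 split: if_splits)
      qed (auto intro: homogeneous_in_generic_sum)
    next
      case False
      then show ?thesis using nzd by (simp add: F_def g_def \<beta>_def \<nu>_def diag_monom_def)
    qed
  qed
  also have "map F [0..<t] = map F [0..<r] @ map F [r..<t]"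
    using upt_add_eq_append[of 0 r "t - r"] r by (simp add: t_def del: upt_Suc flip: map_append)
  also have "map F [0..<r] = generic_polys s n r d"
    unfolding generic_polys_def by (intro nth_equalityI) (auto simp: F_def simp del: upt_Suc)
  also have "map F [r..<t] = map (diag_monom s N) [r + 1..<n 1 + 2]"
    by (intro nth_equalityI) (auto simp: F_def t_def simp del: upt_Suc)
  finally show ?thesis .
qed

corollary regular_seq_generic_polys:
  assumes "\<And>j. j \<in> {1..s} \<Longrightarrow> n 1 \<le> n j" and "r \<le> n 1 + 1"
  shows "regular_seq {} (generic_polys s n r d :: 'k::idom gen_poly list)"
  using regular_seq_generic_polys_monomials[where N = 0 and 'k='k and d = d and s = s and n = n, OF assms] by (simp add: regular_seq_append)

corollary regular_seq_diag_monoms: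
  assumes "\<And>j. j \<in> {1..s} \<Longrightarrow> n 1 \<le> n j" and "r \<le> n 1 + 1"
  shows "regular_seq (set (generic_polys s n r d)) (map (diag_monom s N) [r + 1..<n 1 + 2] :: 'k::idom gen_poly list)"
  using regular_seq_generic_polys_monomials[where N = N and 'k='k and d = d and s = s and n = n, OF assms] by (simp add: regular_seq_append)

lemma prod_var_X_power:
  "(\<Prod>j = 1..s. var_X j k :: 'k::idom gen_poly) ^ N = diag_monom s N k"
proof -
  have pow: "(var_X j k :: 'k gen_poly) ^ N = monom2 (Poly_Mapping.single (j, k) N) 0 1" for j
    by (induction N) (simp_all add: var_X_def monom2_def mult_single flip: single_add)
  have "(\<Prod>j\<in>A. monom2 (Poly_Mapping.single (j, k) N) 0 1) = (monom2 (\<Sum>j\<in>A. Poly_Mapping.single (j, k) N) 0 1 :: 'k gen_poly)"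
    if "finite A" for A
    using that by (induction A) (simp_all add: monom2_mult, simp add: monom2_def)
  then show ?thesis by (simp add: prod_power_distrib pow diag_monom_def diag_expo_def)
qed

lemma diag_monom_in_sigmas_powers:
  assumes "\<And>j. j \<in> {1..s} \<Longrightarrow> k \<in> {1..n j + 1}"
  shows "diag_monom s N k \<in> (\<lambda>x. x ^ N) ` set (sigmas s n :: 'k::idom gen_poly list)"
proof -
  let ?t = "replicate s k"
  have "?t \<in> set (product_lists (map (\<lambda>j. [1..<n j + 2]) [1..<s + 1]))"
  proof -
    have "k \<in> set [1..<n (Suc i) + 2]" if "i < s" for i using assms[of "Suc i"] that by auto
    then show ?thesis by (simp add: product_lists_set list_all2_conv_all_nth del: upt_Suc)
  qed
  then have "(\<Prod>j = 1..s. var_X j (?t ! (j - 1))) \<in> set (sigmas s n :: 'k gen_poly list)"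
    unfolding sigmas_def by (simp only: set_map) (rule imageI)
  moreover have "(\<Prod>j = 1..s. var_X j (?t ! (j - 1))) = (\<Prod>j = 1..s. var_X j k :: 'k gen_poly)"
    by (intro prod.cong arg_cong2[of _ _ _ _ var_X] refl nth_replicate) auto
  ultimately have "(\<Prod>j = 1..s. var_X j k :: 'k gen_poly) \<in> set (sigmas s n)" by simp
  then show ?thesis unfolding prod_var_X_power[symmetric] by (rule imageI)
qed

section \<open>Index sets and vanishing cohomology\<close>

lemma index_sets_subset: "I \<in> index_sets m i \<Longrightarrow> I \<subseteq> {..<m}"
  by (simp add: index_sets_def)

lemma finite_index_sets: "finite (index_sets m i)"
  by (rule finite_subset[of _ "Pow {..<m}"]) (auto simp: index_sets_def)

lemma index_sets_remove: "I \<in> index_sets m (i + 1) \<Longrightarrow> k \<in> I \<Longrightarrow> I - {k} \<in> index_sets m i"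
  using finite_subset[of I "{..<m}"] card_Suc_Diff1[of I k] by (auto simp: index_sets_def)

lemma index_sets_insert:
  "I \<in> index_sets m l \<Longrightarrow> k \<in> {..<m} - I \<Longrightarrow> l' = l + 1 \<Longrightarrow> insert k I \<in> index_sets m l'"
  using finite_subset[of I "{..<m}"] by (auto simp: index_sets_def)

lemma trivial_group_cohomologyI:
  assumes "group_hom (G i) (G (i + 1)) (d i)"
    and ker: "\<And>y. y \<in> carrier (G (i - 1)) \<Longrightarrow> d (i - 1) y \<in> kernel (G i) (G (i + 1)) (d i)"
    and exact: "\<And>x. x \<in> kernel (G i) (G (i + 1)) (d i) \<Longrightarrow> \<exists>y \<in> carrier (G (i - 1)). d (i - 1) y = x"
  shows "trivial_group (cohomology G d i)"
proof -
  interpret group_hom "G i" "G (i + 1)" "d i" by fact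
  define Z where "Z = (G i)\<lparr>carrier := kernel (G i) (G (i + 1)) (d i)\<rparr>"
  interpret Z: group Z
    unfolding Z_def by (rule subgroup.subgroup_is_group[OF subgroup_kernel]) (rule G.is_group)
  have "d (i - 1) ` carrier (G (i - 1)) = carrier Z"
    using ker exact by (fastforce simp: Z_def)
  then have coh: "cohomology G d i = Z Mod carrier Z"
    by (simp add: cohomology_def Z_def)
  have "carrier Z \<lhd> Z" using Z.subgroup_self by (rule Z.normalI) (auto simp: Z.coset_join2 Z.coset_join3 Z.subgroup_self)
  moreover have "carrier (Z Mod carrier Z) = {carrier Z}"
    using Z.one_closed unfolding carrier_FactGroup by (auto simp: Z.coset_join2 Z.subgroup_self intro!: image_eqI)
  ultimately show ?thesis
    unfolding coh trivial_group_def using normal.factorgroup_is_group by simp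
qed

section \<open>Subrings with a linear retraction\<close>

text \<open>Cochains are sought in the ring given by the type \<open>'a\<close>, where ideals are spans, but the complexes
  live over the subring \<open>S\<close>.  The \<open>S\<close>-linear projection \<open>\<pi>\<close> commutes with differentials
  whose coefficients are in \<open>S\<close>, so it carries a solution in the big ring to one over \<open>S\<close>.\<close>

locale retract_subring =
  fixes S :: "'a::comm_ring_1 set" and \<pi> :: "'a \<Rightarrow> 'a"
  assumes zero_mem [simp]: "0 \<in> S" and one_mem [simp]: "1 \<in> S"
    and add_mem [simp]: "x \<in> S \<Longrightarrow> y \<in> S \<Longrightarrow> x + y \<in> S"
    and minus_mem [simp]: "x \<in> S \<Longrightarrow> - x \<in> S"
    and mult_mem [simp]: "x \<in> S \<Longrightarrow> y \<in> S \<Longrightarrow> x * y \<in> S"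
    and retract_mem [simp]: "\<pi> z \<in> S"
    and retract_self: "x \<in> S \<Longrightarrow> \<pi> x = x"
    and retract_add: "\<pi> (z + w) = \<pi> z + \<pi> w"
    and retract_mult: "x \<in> S \<Longrightarrow> \<pi> (x * z) = x * \<pi> z"
begin

abbreviation R :: "'a ring" where "R \<equiv> ring_of_set S"

lemma ring_of_set_simps [simp]:
  "carrier R = S" "x \<otimes>\<^bsub>R\<^esub> y = x * y" "\<one>\<^bsub>R\<^esub> = 1" "\<zero>\<^bsub>R\<^esub> = 0" "x \<oplus>\<^bsub>R\<^esub> y = x + y"
  by (simp_all add: ring_of_set_def)

lemma cring_R: "cring R"
proof (rule cringI)
  show "abelian_group R"
    by (rule abelian_groupI) (auto simp: add_ac intro: bexI[of _ "- x" for x])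
  show "comm_monoid R"
    by (rule comm_monoidI) (auto simp: mult_ac)
qed (simp add: distrib_right)

sublocale R: cring R by (rule cring_R)

lemma a_inv_R [simp]: "x \<in> S \<Longrightarrow> \<ominus>\<^bsub>R\<^esub> x = - x"
  by (rule R.minus_equality) auto

lemma pow_R [simp]: "x [^]\<^bsub>R\<^esub> (k::nat) = x ^ k"
  by (induction k) (simp_all add: mult.commute)

lemma sum_mem: "(\<And>k. k \<in> A \<Longrightarrow> f k \<in> S) \<Longrightarrow> sum f A \<in> S"
  by (induction A rule: infinite_finite_induct) auto

lemma prod_mem: "(\<And>k. k \<in> A \<Longrightarrow> f k \<in> S) \<Longrightarrow> prod f A \<in> S"
  by (induction A rule: infinite_finite_induct) auto

lemma pow_mem [simp]: "x \<in> S \<Longrightarrow> x ^ k \<in> S"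
  by (induction k) auto

lemma finsum_R: "finite A \<Longrightarrow> (\<And>k. k \<in> A \<Longrightarrow> f k \<in> S) \<Longrightarrow> finsum R f A = sum f A"
  by (induction A rule: finite_induct) (auto simp: R.finsum_insert Pi_def)

lemma finprod_R: "finite A \<Longrightarrow> (\<And>k. k \<in> A \<Longrightarrow> f k \<in> S) \<Longrightarrow> finprod R f A = prod f A"
  by (induction A rule: finite_induct) (auto simp: R.finprod_insert Pi_def)

lemma alt_sign_R: "alt_sign R J k = pos_sign J k"
  by (simp add: alt_sign_def pos_sign_def)

lemma pos_sign_mem [simp]: "pos_sign J k \<in> S"
  by (simp add: pos_sign_def)

lemma retract_zero [simp]: "\<pi> 0 = 0"
  by (rule retract_self) simp

lemma retract_sum: "\<pi> (sum f A) = (\<Sum>k\<in>A. \<pi> (f k))"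
  by (induction A rule: infinite_finite_induct) (simp_all add: retract_add)

lemma retract_minus: "\<pi> (- z) = - \<pi> z"
  using retract_mult[of "- 1" z] by simp

lemma retract_diff: "\<pi> (z - w) = \<pi> z - \<pi> w"
  using retract_add[of z "- w"] by (simp add: retract_minus)

lemma retract_koszul_d: "(\<And>k. k \<in> J \<Longrightarrow> x k \<in> S) \<Longrightarrow> \<pi> (koszul_d x b J) = koszul_d x (\<lambda>L. \<pi> (b L)) J"
  unfolding koszul_d_def retract_sum by (intro sum.cong refl) (simp add: retract_mult)

lemma retract_koszul_bd: "(\<And>k. k < m \<Longrightarrow> x k \<in> S) \<Longrightarrow> \<pi> (koszul_bd m x b I) = koszul_bd m x (\<lambda>L. \<pi> (b L)) I"
  unfolding koszul_bd_def retract_sum by (intro sum.cong refl) (simp add: retract_mult)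

lemma retract_span:
  assumes T: "T \<subseteq> S" and a: "a \<in> ring_module.span T"
  shows "\<pi> a \<in> Idl\<^bsub>R\<^esub> T"
  using a
proof (induction rule: ring_module.span_induct_alt)
  case base
  interpret ideal "Idl\<^bsub>R\<^esub> T" R by (rule R.genideal_ideal) (use T in simp)
  show ?case using zero_closed by simp
next
  case (step c x y)
  interpret ideal "Idl\<^bsub>R\<^esub> T" R by (rule R.genideal_ideal) (use T in simp)
  have "x \<in> Idl\<^bsub>R\<^esub> T" using R.genideal_self[of T] T step(1) by auto
  then have "x * \<pi> c \<in> Idl\<^bsub>R\<^esub> T" using I_r_closed[of x "\<pi> c"] by simp
  then show ?case using step a_closed[of "x * \<pi> c" "\<pi> y"] T
    by (auto simp: retract_add mult.commute[of c] retract_mult)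
qed

text \<open>Extending an ideal generated in \<open>S\<close> to the big ring and contracting it again adds nothing: the
  projection turns a combination with coefficients in the big ring into one with coefficients in
  \<open>S\<close>.\<close>

theorem genideal_eq_span:
  assumes "T \<subseteq> S"
  shows "Idl\<^bsub>R\<^esub> T = S \<inter> ring_module.span T"
proof
  have "ideal (S \<inter> ring_module.span T) R"
  proof (rule idealI)
    show "ring R" by (rule R.ring_axioms)
    show "subgroup (S \<inter> ring_module.span T) (add_monoid R)"
    proof (rule R.add.subgroupI)
      show "S \<inter> ring_module.span T \<noteq> {}" using ring_module.span_zero[of T] zero_mem by blast
    qed (auto simp: ring_module.span_add ring_module.span_neg)
  qed (auto simp: ideal_mult_left ideal_mult_right)
  then show "Idl\<^bsub>R\<^esub> T \<subseteq> S \<inter> ring_module.span T"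
    by (rule R.genideal_minimal) (use assms in \<open>auto simp: ring_module.span_base\<close>)
  show "S \<inter> ring_module.span T \<subseteq> Idl\<^bsub>R\<^esub> T"
    using retract_span[OF assms] retract_self by fastforce
qed

section \<open>Acyclicity of the Koszul complex\<close>

lemma koszul_term_mem:
  assumes fs: "set fs \<subseteq> S" and x: "x \<in> carrier (koszul_group R fs i)"
    and I: "I \<in> index_sets (length fs) (- (i + 1))" and k: "k \<in> {..<length fs} - I"
  shows "pos_sign I k * (fs ! k * x (insert k I)) \<in> S"
proof -
  have "insert k I \<in> index_sets (length fs) (- i)"
    by (rule index_sets_insert[OF I k]) simp
  then have "x (insert k I) \<in> S" using x by (auto simp: koszul_group_def)
  moreover have "fs ! k \<in> S" using fs k by auto
  ultimately show ?thesis by simp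
qed

lemma koszul_diff_eq:
  assumes fs: "set fs \<subseteq> S" and x: "x \<in> carrier (koszul_group R fs i)"
  shows "koszul_diff R fs i x = (\<lambda>I \<in> index_sets (length fs) (- (i + 1)). koszul_bd (length fs) ((!) fs) x I)"
  unfolding koszul_diff_def
proof (rule restrict_ext)
  fix I assume I: "I \<in> index_sets (length fs) (- (i + 1))"
  note mem = koszul_term_mem[OF fs x I]
  have "(\<Oplus>\<^bsub>R\<^esub>k\<in>{..<length fs} - I. pos_sign I k * (fs ! k * x (insert k I)))
      = koszul_bd (length fs) ((!) fs) x I"
    unfolding koszul_bd_def by (rule finsum_R) (use mem in auto)
  then show "(\<Oplus>\<^bsub>R\<^esub>k\<in>{..<length fs} - I. alt_sign R I k \<otimes>\<^bsub>R\<^esub> (fs ! k \<otimes>\<^bsub>R\<^esub> x (insert k I)))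
      = koszul_bd (length fs) ((!) fs) x I"
    by (simp add: alt_sign_R)
qed

lemma koszul_bd_mem:
  assumes fs: "set fs \<subseteq> S" and x: "x \<in> carrier (koszul_group R fs i)"
    and I: "I \<in> index_sets (length fs) (- (i + 1))"
  shows "koszul_bd (length fs) ((!) fs) x I \<in> S"
  unfolding koszul_bd_def by (rule sum_mem) (rule koszul_term_mem[OF assms])

lemma group_koszul_group: "group (koszul_group R fs i)"
  unfolding koszul_group_def by (intro product_group R.a_group)

lemma koszul_diff_mem:
  assumes "set fs \<subseteq> S" and "x \<in> carrier (koszul_group R fs i)"
  shows "koszul_diff R fs i x \<in> carrier (koszul_group R fs (i + 1))"
  using koszul_bd_mem[OF assms] by (auto simp: koszul_diff_eq[OF assms] koszul_group_def)

lemma group_hom_koszul_diff: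
  assumes fs: "set fs \<subseteq> S"
  shows "group_hom (koszul_group R fs i) (koszul_group R fs (i + 1)) (koszul_diff R fs i)"
proof (intro group_hom.intro group_hom_axioms.intro group_koszul_group homI)
  fix x y assume x: "x \<in> carrier (koszul_group R fs i)" and y: "y \<in> carrier (koszul_group R fs i)"
  let ?xy = "x \<otimes>\<^bsub>koszul_group R fs i\<^esub> y"
  have xy: "?xy \<in> carrier (koszul_group R fs i)"
    using group.is_monoid[OF group_koszul_group] x y by (rule monoid.m_closed)
  show "koszul_diff R fs i ?xy
      = koszul_diff R fs i x \<otimes>\<^bsub>koszul_group R fs (i + 1)\<^esub> koszul_diff R fs i y"
    unfolding koszul_diff_eq[OF fs xy] koszul_diff_eq[OF fs x] koszul_diff_eq[OF fs y]
  proof (rule ext)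
    fix I
    show "restrict (koszul_bd (length fs) ((!) fs) ?xy) (index_sets (length fs) (- (i + 1))) I =
      (restrict (koszul_bd (length fs) ((!) fs) x) (index_sets (length fs) (- (i + 1)))
        \<otimes>\<^bsub>koszul_group R fs (i + 1)\<^esub> restrict (koszul_bd (length fs) ((!) fs) y) (index_sets (length fs) (- (i + 1)))) I"
    proof (cases "I \<in> index_sets (length fs) (- (i + 1))")
      case True
      have "koszul_bd (length fs) ((!) fs) ?xy I
          = (\<Sum>k\<in>{..<length fs} - I. pos_sign I k * (fs ! k * x (insert k I)) + pos_sign I k * (fs ! k * y (insert k I)))"
        unfolding koszul_bd_def
      proof (rule sum.cong[OF refl])
        fix k assume k: "k \<in> {..<length fs} - I"
        have "insert k I \<in> index_sets (length fs) (- i)"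
          by (rule index_sets_insert[OF True k]) simp
        then show "pos_sign I k * (fs ! k * ?xy (insert k I))
          = pos_sign I k * (fs ! k * x (insert k I)) + pos_sign I k * (fs ! k * y (insert k I))"
          by (simp add: koszul_group_def algebra_simps)
      qed
      also have "\<dots> = koszul_bd (length fs) ((!) fs) x I + koszul_bd (length fs) ((!) fs) y I"
        by (simp add: koszul_bd_def sum.distrib)
      finally show ?thesis using True by (simp add: koszul_group_def)
    qed (simp add: koszul_group_def)
  qed
qed (rule koszul_diff_mem[OF fs])

text \<open>In positive degrees the complex is zero.  In degree \<open>-l\<close> with \<open>l > 0\<close> a cycle bounds a chain with
  entries in the big ring, and the projection of that chain to \<open>S\<close> has the same boundary.\<close>

theorem koszul_acyclic:
  assumes fs: "set fs \<subseteq> S" and reg: "regular_seq {} fs" and "i \<noteq> 0"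
  shows "trivial_group (koszul_cohomology R fs i)"
  unfolding koszul_cohomology_def
proof (rule trivial_group_cohomologyI)
  let ?m = "length fs"
  let ?K = "kernel (koszul_group R fs i) (koszul_group R fs (i + 1)) (koszul_diff R fs i)"
  show "group_hom (koszul_group R fs i) (koszul_group R fs (i + 1)) (koszul_diff R fs i)"
    by (rule group_hom_koszul_diff[OF fs])
  have fsm: "fs ! k \<in> S" if "k < ?m" for k using fs that by auto
  show "koszul_diff R fs (i - 1) y \<in> ?K" if y: "y \<in> carrier (koszul_group R fs (i - 1))" for y
  proof -
    let ?x = "koszul_diff R fs (i - 1) y"
    have x: "?x \<in> carrier (koszul_group R fs i)" using koszul_diff_mem[OF fs y] by simp
    have "koszul_bd ?m ((!) fs) ?x I = 0" if I: "I \<in> index_sets ?m (- (i + 1))" for I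
    proof -
      have "koszul_bd ?m ((!) fs) ?x I = koszul_bd ?m ((!) fs) (koszul_bd ?m ((!) fs) y) I"
      proof (rule koszul_bd_cong)
        fix k assume k: "k \<in> {..<?m} - I"
        have "insert k I \<in> index_sets ?m (- i)"
          by (rule index_sets_insert[OF I k]) simp
        then show "?x (insert k I) = koszul_bd ?m ((!) fs) y (insert k I)"
          by (simp add: koszul_diff_eq[OF fs y])
      qed
      then show ?thesis using I by (simp add: koszul_bd_koszul_bd index_sets_def)
    qed
    then have "koszul_diff R fs i ?x = \<one>\<^bsub>koszul_group R fs (i + 1)\<^esub>"
      by (auto simp: koszul_diff_eq[OF fs x] koszul_group_def cong: restrict_cong)
    then show ?thesis using x by (simp add: kernel_def)
  qed
  show "\<exists>y\<in>carrier (koszul_group R fs (i - 1)). koszul_diff R fs (i - 1) y = x" if xK: "x \<in> ?K" for x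
  proof -
    have x: "x \<in> carrier (koszul_group R fs i)" and dx: "koszul_diff R fs i x = \<one>\<^bsub>koszul_group R fs (i + 1)\<^esub>"
      using xK by (auto simp: kernel_def)
    have cyc: "koszul_bd ?m ((!) fs) x I = 0" if "I \<in> index_sets ?m (- (i + 1))" for I
      using fun_cong[OF dx, of I] that by (simp add: koszul_diff_eq[OF fs x] koszul_group_def)
    have "\<exists>b. \<forall>I \<in> index_sets ?m (- i). x I = koszul_bd ?m ((!) fs) b I"
    proof (cases "i < 0")
      case True
      define l where "l = nat (- i)"
      have "\<exists>b. \<forall>I. I \<subseteq> {..<?m} \<longrightarrow> card I = l \<longrightarrow> x I = koszul_bd ?m ((!) fs) b I"
      proof (rule koszul_homology_vanishing)
        show "regular_seq {} (map ((!) fs) [0..<?m])" using reg by (simp add: map_nth)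
        show "0 < l" using True by (simp add: l_def)
        show "koszul_bd ?m ((!) fs) x I = 0" if "I \<subseteq> {..<?m}" "Suc (card I) = l" for I
          by (rule cyc) (use that True in \<open>auto simp: index_sets_def l_def\<close>)
      qed
      then show ?thesis using True by (auto simp: index_sets_def l_def)
    next
      case False
      then show ?thesis using \<open>i \<noteq> 0\<close> by (auto simp: index_sets_def)
    qed
    then obtain b where b: "\<And>I. I \<in> index_sets ?m (- i) \<Longrightarrow> x I = koszul_bd ?m ((!) fs) b I" by blast
    define y where "y = (\<lambda>I \<in> index_sets ?m (- (i - 1)). \<pi> (b I))"
    have y: "y \<in> carrier (koszul_group R fs (i - 1))" by (simp add: y_def koszul_group_def)
    have "koszul_diff R fs (i - 1) y = x"
    proof (rule ext)
      fix I
      show "koszul_diff R fs (i - 1) y I = x I"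
      proof (cases "I \<in> index_sets ?m (- i)")
        case True
        have "koszul_diff R fs (i - 1) y I = koszul_bd ?m ((!) fs) (\<lambda>L. \<pi> (b L)) I"
          using True unfolding koszul_diff_eq[OF fs y]
        proof (simp, intro koszul_bd_cong)
          fix k assume k: "k \<in> {..<?m} - I"
          have "insert k I \<in> index_sets ?m (- (i - 1))"
            by (rule index_sets_insert[OF True k]) simp
          then show "y (insert k I) = \<pi> (b (insert k I))" by (simp add: y_def)
        qed
        also have "\<dots> = \<pi> (x I)" using b[OF True] by (simp add: retract_koszul_bd fsm)
        also have "\<dots> = x I" using x True by (intro retract_self) (auto simp: koszul_group_def)
        finally show ?thesis .
      next
        case False
        then show ?thesis using x unfolding koszul_diff_eq[OF fs y]
          by (auto simp: koszul_group_def PiE_def extensional_def)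
      qed
    qed
    then show ?thesis using y by blast
  qed
qed

end

section \<open>Fractions over a quotient ring\<close>

text \<open>The module \<open>M\<close> below is the quotient of \<open>S\<close> by the ideal generated by \<open>T\<close>.  Its elements are the
  residue classes \<open>res a\<close>, and congruence is membership of the difference in the span of \<open>T\<close> in the
  big ring.\<close>

locale retract_quotient = retract_subring +
  fixes T :: "'a::comm_ring_1 set"
  assumes T_sub: "T \<subseteq> S"
begin

abbreviation J :: "'a set" where "J \<equiv> Idl\<^bsub>R\<^esub> T"
abbreviation M :: "('a, 'a set) module" where "M \<equiv> quotient_module R J"
definition res :: "'a \<Rightarrow> 'a set" where "res a = J +>\<^bsub>R\<^esub> a"

lemma J_eq: "J = S \<inter> ring_module.span T"
  by (rule genideal_eq_span[OF T_sub])

sublocale J: ideal J R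
  by (rule R.genideal_ideal) (use T_sub in simp)

lemma res_eq_iff:
  assumes "a \<in> S" "b \<in> S"
  shows "res a = res b \<longleftrightarrow> a - b \<in> ring_module.span T"
proof -
  have res: "res c = {j + c | j. j \<in> J}" for c
    by (auto simp: res_def a_r_coset_def')
  show ?thesis
  proof
    assume "res a = res b"
    moreover have "a \<in> res a" unfolding res using J.zero_closed by force
    ultimately have "a \<in> res b" by simp
    then show "a - b \<in> ring_module.span T" unfolding res by (auto simp: J_eq)
  next
    assume ab: "a - b \<in> ring_module.span T"
    have "x \<in> res c'" if "x \<in> res c" "c - c' \<in> ring_module.span T" "c \<in> S" "c' \<in> S" for x c c'
    proof -
      obtain j where j: "x = j + c" "j \<in> J" using \<open>x \<in> res c\<close> unfolding res by auto
      have "j + (c - c') \<in> J"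
        using j that add_mem[of c "- c'"] by (simp add: J_eq ring_module.span_add)
      then show ?thesis unfolding res j(1) by (force intro: exI[of _ "j + (c - c')"])
    qed
    from this[OF _ ab] this[OF _ ring_module.span_neg[OF ab, simplified]] show "res a = res b"
      using assms by auto
  qed
qed

lemma carrier_M: "carrier M = res ` S"
  by (auto simp: quotient_module_def ring.defs FactRing_def A_RCOSETS_def' res_def)

lemma M_add: "a \<in> S \<Longrightarrow> b \<in> S \<Longrightarrow> res a \<oplus>\<^bsub>M\<^esub> res b = res (a + b)"
  by (simp add: quotient_module_def ring.defs FactRing_def res_def J.a_rcos_sum)

lemma M_smult: "a \<in> S \<Longrightarrow> c \<in> S \<Longrightarrow> c \<odot>\<^bsub>M\<^esub> res a = res (c * a)"
  by (simp add: quotient_module_def ring.defs FactRing_def res_def J.rcoset_mult_add)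

lemma M_zero: "\<zero>\<^bsub>M\<^esub> = res 0"
proof -
  have "res 0 = J" by (auto simp: res_def a_r_coset_def')
  then show ?thesis by (simp add: quotient_module_def ring.defs FactRing_def)
qed

text \<open>Localizations are handled through numerators in \<open>S\<close> and exponents, so that cochains with values in
  them become families of elements of \<open>S\<close>.\<close>

definition fraction :: "'a \<Rightarrow> 'a \<Rightarrow> nat \<Rightarrow> ('a set \<times> nat) set" where
  "fraction g a k = loc_frac R M g (res a) k"

lemma loc_rel_iff:
  assumes "g \<in> S" "a \<in> S" "b \<in> S"
  shows "((res a, k), (res b, l)) \<in> loc_rel R M g \<longleftrightarrow>
     (\<exists>c. g ^ (c + l) * a - g ^ (c + k) * b \<in> ring_module.span T)"
  using assms by (simp add: loc_rel_def M_smult res_eq_iff carrier_M)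

lemma equiv_loc_rel:
  assumes g: "g \<in> S"
  shows "equiv (carrier M \<times> UNIV) (loc_rel R M g)"
proof (rule equivI)
  show "loc_rel R M g \<subseteq> (carrier M \<times> UNIV) \<times> (carrier M \<times> UNIV)"
    by (auto simp: loc_rel_def)
  show "refl_on (carrier M \<times> UNIV) (loc_rel R M g)"
    by (rule refl_onI) (auto simp: loc_rel_def)
  show "sym (loc_rel R M g)"
    by (rule symI) (auto simp: loc_rel_def intro: sym)
  show "trans (loc_rel R M g)"
  proof (rule transI)
    fix u v w assume uv: "(u, v) \<in> loc_rel R M g" and vw: "(v, w) \<in> loc_rel R M g"
    obtain a k b l e i where u: "u = (res a, k)" "v = (res b, l)" "w = (res e, i)" and S: "a \<in> S" "b \<in> S" "e \<in> S"
      using uv vw by (auto simp: loc_rel_def carrier_M)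
    obtain c c' where c: "g ^ (c + l) * a - g ^ (c + k) * b \<in> ring_module.span T"
      and c': "g ^ (c' + i) * b - g ^ (c' + l) * e \<in> ring_module.span T"
      using uv vw unfolding u by (auto simp: loc_rel_iff g S)
    have "g ^ (c + c' + l + i) * a - g ^ (c + c' + l + k) * e
       = g ^ (c' + i) * (g ^ (c + l) * a - g ^ (c + k) * b) + g ^ (c + k) * (g ^ (c' + i) * b - g ^ (c' + l) * e)"
      by (simp add: algebra_simps power_add)
    also have "\<dots> \<in> ring_module.span T"
      by (intro ring_module.span_add ideal_mult_left c c')
    finally show "(u, w) \<in> loc_rel R M g" unfolding u by (auto simp: loc_rel_iff g S)
  qed
qed

lemma fraction_eq_iff:
  assumes "g \<in> S" "a \<in> S" "b \<in> S"
  shows "fraction g a k = fraction g b l \<longleftrightarrow> (\<exists>c. g ^ (c + l) * a - g ^ (c + k) * b \<in> ring_module.span T)"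
  unfolding fraction_def loc_frac_def
  using assms eq_equiv_class_iff[OF equiv_loc_rel[OF assms(1)], of "(res a, k)" "(res b, l)"]
  by (simp add: carrier_M loc_rel_iff)

lemma fraction_eqI:
  assumes "g \<in> S" "a \<in> S" "b \<in> S" "g ^ l * a = g ^ k * b"
  shows "fraction g a k = fraction g b l"
  using assms by (auto simp: fraction_eq_iff ring_module.span_zero intro!: exI[of _ 0])

lemma fraction_congI:
  assumes "g \<in> S" "a \<in> S" "b \<in> S" "a - b \<in> ring_module.span T"
  shows "fraction g a k = fraction g b k"
proof -
  have "g ^ (0 + k) * a - g ^ (0 + k) * b = g ^ k * (a - b)" by (simp add: algebra_simps)
  then show ?thesis using assms by (auto simp: fraction_eq_iff intro!: exI[of _ 0] ideal_mult_left)
qed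

lemma mem_fraction:
  assumes "g \<in> S" "a \<in> S" "(m, l) \<in> fraction g a k"
  obtains b where "b \<in> S" "m = res b" "fraction g b l = fraction g a k"
proof -
  have rel: "((res a, k), (m, l)) \<in> loc_rel R M g"
    using assms(3) by (simp add: fraction_def loc_frac_def)
  then obtain b where b: "b \<in> S" "m = res b" by (auto simp: loc_rel_def carrier_M)
  moreover have "fraction g b l = fraction g a k"
    using equiv_class_eq[OF equiv_loc_rel[OF assms(1)] rel] by (simp add: fraction_def loc_frac_def b)
  ultimately show ?thesis by (rule that)
qed

lemma self_mem_fraction:
  assumes "g \<in> S" "a \<in> S"
  shows "(res a, k) \<in> fraction g a k"
  unfolding fraction_def loc_frac_def
  using equiv_class_self[OF equiv_loc_rel[OF assms(1)], of "(res a, k)"] assms by (simp add: carrier_M)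

lemma fraction_add_cong:
  assumes g: "g \<in> S" and S: "a \<in> S" "b \<in> S" "a' \<in> S" "b' \<in> S"
    and eq: "fraction g a k = fraction g a' k'" "fraction g b l = fraction g b' l'"
  shows "fraction g (g ^ l * a + g ^ k * b) (k + l) = fraction g (g ^ l' * a' + g ^ k' * b') (k' + l')"
proof -
  obtain c c' where c: "g ^ (c + k') * a - g ^ (c + k) * a' \<in> ring_module.span T"
    and c': "g ^ (c' + l') * b - g ^ (c' + l) * b' \<in> ring_module.span T"
    using eq by (auto simp: fraction_eq_iff g S)
  have "g ^ (c + c' + (k' + l')) * (g ^ l * a + g ^ k * b) - g ^ (c + c' + (k + l)) * (g ^ l' * a' + g ^ k' * b')
     = g ^ (c' + l + l') * (g ^ (c + k') * a - g ^ (c + k) * a')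
       + g ^ (c + k + k') * (g ^ (c' + l') * b - g ^ (c' + l) * b')"
    by (simp add: algebra_simps power_add)
  also have "\<dots> \<in> ring_module.span T"
    by (intro ring_module.span_add ideal_mult_left c c')
  finally show ?thesis using g S by (auto simp: fraction_eq_iff)
qed

abbreviation L :: "'a \<Rightarrow> ('a, ('a set \<times> nat) set) module" where "L g \<equiv> localization R M g"

lemma carrier_L: "carrier (L g) = {fraction g a k | a k. a \<in> S}"
  by (auto simp: localization_def quotient_def fraction_def loc_frac_def carrier_M)

lemma fraction_in_L [simp]: "a \<in> S \<Longrightarrow> fraction g a k \<in> carrier (L g)"
  by (auto simp: carrier_L)

lemma L_zero: "\<zero>\<^bsub>L g\<^esub> = fraction g 0 0"
  by (simp add: localization_def fraction_def M_zero)

text \<open>The sum of two fractions is a union over all representatives of both; all of them yield the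
  same class, by \<open>fraction_add_cong\<close>.\<close>

lemma L_add:
  assumes g: "g \<in> S" and S: "a \<in> S" "b \<in> S"
  shows "fraction g a k \<oplus>\<^bsub>L g\<^esub> fraction g b l = fraction g (g ^ l * a + g ^ k * b) (k + l)"
proof -
  define h where "h = (\<lambda>u v. case u of (m, k) \<Rightarrow> case v of (m', l) \<Rightarrow>
      loc_frac R M g ((g [^]\<^bsub>R\<^esub> l) \<odot>\<^bsub>M\<^esub> m \<oplus>\<^bsub>M\<^esub> (g [^]\<^bsub>R\<^esub> k) \<odot>\<^bsub>M\<^esub> m') (k + l))"
  have "h u v = fraction g (g ^ l * a + g ^ k * b) (k + l)" if mem: "u \<in> fraction g a k" "v \<in> fraction g b l" for u v
  proof -
    obtain m i where u: "u = (m, i)" by (cases u)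
    obtain m' j where v: "v = (m', j)" by (cases v)
    obtain a' where a': "a' \<in> S" "m = res a'" "fraction g a' i = fraction g a k"
      using mem_fraction[OF g S(1)] mem(1) u by blast
    obtain b' where b': "b' \<in> S" "m' = res b'" "fraction g b' j = fraction g b l"
      using mem_fraction[OF g S(2)] mem(2) v by blast
    have "h u v = fraction g (g ^ j * a' + g ^ i * b') (i + j)"
      using g a'(1) b'(1) by (simp add: h_def u v a'(2) b'(2) M_smult M_add fraction_def)
    also have "\<dots> = fraction g (g ^ l * a + g ^ k * b) (k + l)"
      by (rule fraction_add_cong) (use g S a' b' in auto)
    finally show ?thesis .
  qed
  then have "(\<Union>u\<in>fraction g a k. \<Union>v\<in>fraction g b l. h u v) = (\<Union>u\<in>fraction g a k. \<Union>v\<in>fraction g b l. fraction g (g ^ l * a + g ^ k * b) (k + l))"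
    by (intro SUP_cong refl) auto
  also have "\<dots> = fraction g (g ^ l * a + g ^ k * b) (k + l)"
    using self_mem_fraction[OF g S(1), of k] self_mem_fraction[OF g S(2), of l] by blast
  also have "(\<Union>u\<in>fraction g a k. \<Union>v\<in>fraction g b l. h u v) = fraction g a k \<oplus>\<^bsub>L g\<^esub> fraction g b l"
    by (simp add: localization_def h_def split_def)
  finally show ?thesis .
qed

lemma fraction_expand:
  assumes "g \<in> S" "a \<in> S"
  shows "fraction g (g ^ c * a) (k + c) = fraction g a k"
  by (rule fraction_eqI) (use assms in \<open>auto simp: power_add mult_ac\<close>)

lemma L_add_same:
  assumes "g \<in> S" "a \<in> S" "b \<in> S"
  shows "fraction g a k \<oplus>\<^bsub>L g\<^esub> fraction g b k = fraction g (a + b) k"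
  using fraction_expand[of g "a + b" k k] assms by (simp add: L_add distrib_left)

lemma L_smult:
  assumes g: "g \<in> S" and S: "a \<in> S" "c \<in> S"
  shows "c \<odot>\<^bsub>L g\<^esub> fraction g a k = fraction g (c * a) k"
proof -
  have "(case u of (m, i) \<Rightarrow> loc_frac R M g (c \<odot>\<^bsub>M\<^esub> m) i) = fraction g (c * a) k" if mem: "u \<in> fraction g a k" for u
  proof -
    obtain m i where u: "u = (m, i)" by (cases u)
    obtain b where b: "b \<in> S" "m = res b" "fraction g b i = fraction g a k"
      using mem_fraction[OF g S(1)] mem u by blast
    obtain e where e: "g ^ (e + k) * b - g ^ (e + i) * a \<in> ring_module.span T"
      using b by (auto simp: fraction_eq_iff g S)
    have "g ^ (e + k) * (c * b) - g ^ (e + i) * (c * a) = c * (g ^ (e + k) * b - g ^ (e + i) * a)"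
      by (simp add: algebra_simps)
    then have "fraction g (c * b) i = fraction g (c * a) k"
      using ideal_mult_left[OF e, of c] b S g by (auto simp: fraction_eq_iff intro!: exI[of _ e])
    then show ?thesis using b S by (simp add: u M_smult fraction_def)
  qed
  then have "(\<Union>u\<in>fraction g a k. case u of (m, i) \<Rightarrow> loc_frac R M g (c \<odot>\<^bsub>M\<^esub> m) i) = (\<Union>u\<in>fraction g a k. fraction g (c * a) k)"
    by (intro SUP_cong refl) auto
  also have "\<dots> = fraction g (c * a) k" using self_mem_fraction[OF g S(1), of k] by blast
  finally show ?thesis by (simp add: localization_def)
qed

lemma loc_map_fraction:
  assumes g: "g \<in> S" and h: "h \<in> S" and a: "a \<in> S"
  shows "loc_map R M g h (fraction g a k) = fraction (g * h) (h ^ k * a) k"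
proof -
  have "(case u of (m, i) \<Rightarrow> loc_frac R M (g \<otimes>\<^bsub>R\<^esub> h) ((h [^]\<^bsub>R\<^esub> i) \<odot>\<^bsub>M\<^esub> m) i) = fraction (g * h) (h ^ k * a) k"
    if mem: "u \<in> fraction g a k" for u
  proof -
    obtain m i where u: "u = (m, i)" by (cases u)
    obtain b where b: "b \<in> S" "m = res b" "fraction g b i = fraction g a k"
      using mem_fraction[OF g a] mem u by blast
    obtain e where e: "g ^ (e + k) * b - g ^ (e + i) * a \<in> ring_module.span T"
      using b by (auto simp: fraction_eq_iff g a)
    have "(g * h) ^ (e + k) * (h ^ i * b) - (g * h) ^ (e + i) * (h ^ k * a)
        = h ^ (e + k + i) * (g ^ (e + k) * b - g ^ (e + i) * a)"
      by (simp add: algebra_simps power_add power_mult_distrib)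
    then have "fraction (g * h) (h ^ i * b) i = fraction (g * h) (h ^ k * a) k"
      using ideal_mult_left[OF e, of "h ^ (e + k + i)"] b a g h
      by (auto simp: fraction_eq_iff intro!: exI[of _ e])
    then show ?thesis using b h by (simp add: u M_smult fraction_def)
  qed
  then have "(\<Union>u\<in>fraction g a k. case u of (m, i) \<Rightarrow> loc_frac R M (g \<otimes>\<^bsub>R\<^esub> h) ((h [^]\<^bsub>R\<^esub> i) \<odot>\<^bsub>M\<^esub> m) i)
      = (\<Union>u\<in>fraction g a k. fraction (g * h) (h ^ k * a) k)"
    by (intro SUP_cong refl) auto
  also have "\<dots> = fraction (g * h) (h ^ k * a) k" using self_mem_fraction[OF g a, of k] by blast
  finally show ?thesis by (simp add: loc_map_def)
qed

lemma fraction_zero: "g \<in> S \<Longrightarrow> fraction g 0 k = \<zero>\<^bsub>L g\<^esub>"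
  unfolding L_zero by (rule fraction_eqI) auto

lemma abelian_group_L:
  assumes g: "g \<in> S"
  shows "abelian_group (L g)"
proof (rule abelian_groupI)
  show "x \<oplus>\<^bsub>L g\<^esub> y \<in> carrier (L g)" if xy: "x \<in> carrier (L g)" "y \<in> carrier (L g)" for x y
  proof -
    obtain a k b l where "a \<in> S" "b \<in> S" "x = fraction g a k" "y = fraction g b l"
      using xy unfolding carrier_L by blast
    then show ?thesis using g by (simp add: L_add)
  qed
  show "\<zero>\<^bsub>L g\<^esub> \<in> carrier (L g)" by (simp add: L_zero)
  show "(x \<oplus>\<^bsub>L g\<^esub> y) \<oplus>\<^bsub>L g\<^esub> z = x \<oplus>\<^bsub>L g\<^esub> (y \<oplus>\<^bsub>L g\<^esub> z)"
    if xyz: "x \<in> carrier (L g)" "y \<in> carrier (L g)" "z \<in> carrier (L g)" for x y z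
  proof -
    obtain a k b l c i where S: "a \<in> S" "b \<in> S" "c \<in> S"
      and eq: "x = fraction g a k" "y = fraction g b l" "z = fraction g c i"
      using xyz unfolding carrier_L by blast
    show ?thesis unfolding eq using g S
      by (simp add: L_add, intro fraction_eqI) (auto simp: algebra_simps power_add)
  qed
  show "x \<oplus>\<^bsub>L g\<^esub> y = y \<oplus>\<^bsub>L g\<^esub> x" if "x \<in> carrier (L g)" "y \<in> carrier (L g)" for x y
    using that g by (auto simp: carrier_L L_add add.commute)
  show "\<zero>\<^bsub>L g\<^esub> \<oplus>\<^bsub>L g\<^esub> x = x" if "x \<in> carrier (L g)" for x
    using that g by (auto simp: carrier_L L_add L_zero)
  show "\<exists>y\<in>carrier (L g). y \<oplus>\<^bsub>L g\<^esub> x = \<zero>\<^bsub>L g\<^esub>" if x: "x \<in> carrier (L g)" for x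
  proof -
    obtain a k where a: "a \<in> S" "x = fraction g a k" using x by (auto simp: carrier_L)
    then have "fraction g (- a) k \<oplus>\<^bsub>L g\<^esub> x = \<zero>\<^bsub>L g\<^esub>"
      using L_add_same[OF g, of "- a" a k] g by (simp add: fraction_zero)
    then show ?thesis using a by (intro bexI[of _ "fraction g (- a) k"]) auto
  qed
qed

lemma finsum_L_fraction:
  assumes g: "g \<in> S" and "finite A" and "\<And>k. k \<in> A \<Longrightarrow> f k \<in> S"
  shows "(\<Oplus>\<^bsub>L g\<^esub>k\<in>A. fraction g (f k) N) = fraction g (sum f A) N"
proof -
  interpret abelian_group "L g" by (rule abelian_group_L[OF g])
  show ?thesis using assms(2,3)
    by (induction A rule: finite_induct) (auto simp: fraction_zero g finsum_insert Pi_def L_add_same sum_mem)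
qed

end

section \<open>Cech cochains with a common denominator\<close>

context retract_quotient
begin

definition sub_prod :: "'a list \<Rightarrow> nat set \<Rightarrow> 'a" where
  "sub_prod xs I = (\<Prod>k\<in>I. xs ! k)"

lemma nth_mem_S: "set xs \<subseteq> S \<Longrightarrow> I \<subseteq> {..<length xs} \<Longrightarrow> k \<in> I \<Longrightarrow> xs ! k \<in> S"
  by (meson lessThan_iff nth_mem subsetD)

lemma sub_prod_mem: "set xs \<subseteq> S \<Longrightarrow> I \<subseteq> {..<length xs} \<Longrightarrow> sub_prod xs I \<in> S"
  unfolding sub_prod_def by (rule prod_mem) (rule nth_mem_S)

lemma prod_of_eq: "set xs \<subseteq> S \<Longrightarrow> I \<subseteq> {..<length xs} \<Longrightarrow> prod_of R xs I = sub_prod xs I"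
  unfolding prod_of_def sub_prod_def by (rule finprod_R) (auto intro: finite_subset nth_mem_S)

lemma sub_prod_remove: "finite I \<Longrightarrow> k \<in> I \<Longrightarrow> sub_prod xs (I - {k}) * xs ! k = sub_prod xs I"
  by (simp add: sub_prod_def prod.remove mult.commute)

text \<open>The Cech cochain whose entries have numerators \<open>a I\<close> and the common exponent \<open>N\<close>.  As there are
  finitely many index sets, every cochain has this form (\<open>cochain_cases\<close>).\<close>

definition cochain :: "'a list \<Rightarrow> int \<Rightarrow> (nat set \<Rightarrow> 'a) \<Rightarrow> nat \<Rightarrow> nat set \<Rightarrow> ('a set \<times> nat) set" where
  "cochain xs i a N = (\<lambda>I \<in> index_sets (length xs) i. fraction (sub_prod xs I) (a I) N)"

lemma carrier_cech_group:
  assumes "set xs \<subseteq> S"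
  shows "carrier (cech_group R M xs i) = (\<Pi>\<^sub>E I \<in> index_sets (length xs) i. carrier (L (sub_prod xs I)))"
  unfolding cech_group_def carrier_product_group
  by (intro PiE_cong) (simp add: prod_of_eq[OF assms index_sets_subset])

lemma one_cech_group:
  assumes "set xs \<subseteq> S"
  shows "\<one>\<^bsub>cech_group R M xs i\<^esub> = cochain xs i (\<lambda>_. 0) N"
  unfolding cech_group_def cochain_def one_product_group
  by (intro restrict_ext)
    (simp add: prod_of_eq[OF assms index_sets_subset] fraction_zero sub_prod_mem[OF assms index_sets_subset])

lemma group_cech_group:
  assumes "set xs \<subseteq> S"
  shows "group (cech_group R M xs i)"
  unfolding cech_group_def
proof (rule product_group)
  fix I assume "I \<in> index_sets (length xs) i"
  then show "group (add_monoid (L (prod_of R xs I)))"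
    using abelian_group.a_group[OF abelian_group_L[OF sub_prod_mem[OF assms index_sets_subset]]]
    by (simp add: prod_of_eq[OF assms index_sets_subset])
qed

lemma cochain_mem:
  assumes "set xs \<subseteq> S" "\<And>I. I \<in> index_sets (length xs) i \<Longrightarrow> a I \<in> S"
  shows "cochain xs i a N \<in> carrier (cech_group R M xs i)"
  using assms(2) by (simp add: carrier_cech_group[OF assms(1)] cochain_def)

lemma cochain_expand:
  assumes "set xs \<subseteq> S" "\<And>I. I \<in> index_sets (length xs) i \<Longrightarrow> a I \<in> S"
  shows "cochain xs i (\<lambda>I. sub_prod xs I ^ c * a I) (N + c) = cochain xs i a N"
  unfolding cochain_def
  by (intro restrict_ext fraction_expand sub_prod_mem[OF assms(1) index_sets_subset] assms(2))

lemma cochain_cases: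
  assumes xs: "set xs \<subseteq> S" and x: "x \<in> carrier (cech_group R M xs i)"
  obtains a N where "\<And>I. a I \<in> S" "x = cochain xs i a N"
proof -
  let ?A = "index_sets (length xs) i"
  have "\<forall>I. \<exists>b k. I \<in> ?A \<longrightarrow> b \<in> S \<and> x I = fraction (sub_prod xs I) b k"
    using x unfolding carrier_cech_group[OF xs] by (auto simp: carrier_L dest!: PiE_mem)
  then obtain b k where bk: "\<And>I. I \<in> ?A \<Longrightarrow> b I \<in> S \<and> x I = fraction (sub_prod xs I) (b I) (k I)"
    by metis
  define N where "N = (\<Sum>I\<in>?A. k I)"
  define a where "a I = (if I \<in> ?A then sub_prod xs I ^ (N - k I) * b I else 0)" for I
  have a: "a I \<in> S" for I
    using bk sub_prod_mem[OF xs index_sets_subset] by (auto simp: a_def)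
  have "x = cochain xs i a N"
  proof (rule ext)
    fix I
    show "x I = cochain xs i a N I"
    proof (cases "I \<in> ?A")
      case True
      have "k I \<le> N" unfolding N_def by (rule member_le_sum[OF True]) (simp_all add: finite_index_sets)
      then show ?thesis
        using fraction_expand[of "sub_prod xs I" "b I" "N - k I" "k I"] bk[OF True] True
          sub_prod_mem[OF xs index_sets_subset[OF True]]
        by (simp add: cochain_def a_def)
    next
      case False
      then show ?thesis using x unfolding carrier_cech_group[OF xs] by (auto simp: cochain_def)
    qed
  qed
  with a show ?thesis by (rule that)
qed

lemma cochain_mult:
  assumes xs: "set xs \<subseteq> S" and a: "\<And>I. I \<in> index_sets (length xs) i \<Longrightarrow> a I \<in> S"
    and b: "\<And>I. I \<in> index_sets (length xs) i \<Longrightarrow> b I \<in> S"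
  shows "cochain xs i a N \<otimes>\<^bsub>cech_group R M xs i\<^esub> cochain xs i b N = cochain xs i (\<lambda>I. a I + b I) N"
  unfolding cech_group_def mult_product_group
  unfolding cochain_def
  by (intro restrict_ext)
    (simp add: prod_of_eq[OF xs index_sets_subset] L_add_same[OF sub_prod_mem[OF xs index_sets_subset]] a b)

lemma koszul_d_mem:
  assumes "set xs \<subseteq> S" "I \<subseteq> {..<length xs}" "\<And>k. k \<in> I \<Longrightarrow> a (I - {k}) \<in> S"
  shows "koszul_d (\<lambda>k. xs ! k ^ N) a I \<in> S"
  unfolding koszul_d_def
proof (rule sum_mem)
  fix k assume k: "k \<in> I"
  then have "xs ! k \<in> S" using nth_mem_S[OF assms(1,2)] by simp
  then show "pos_sign I k * (xs ! k ^ N * a (I - {k})) \<in> S" using assms(3)[OF k] by simp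
qed

text \<open>The restriction map multiplies the numerator at \<open>I - {k}\<close> by the \<open>N\<close>-th power of the \<open>k\<close>-th member of
  \<open>xs\<close>.  Therefore the Cech differential acts on numerators as the Koszul differential of the
  \<open>N\<close>-th powers.\<close>

lemma cech_diff_cochain:
  assumes xs: "set xs \<subseteq> S" and a: "\<And>I. I \<in> index_sets (length xs) i \<Longrightarrow> a I \<in> S"
  shows "cech_diff R M xs i (cochain xs i a N) = cochain xs (i + 1) (koszul_d (\<lambda>k. xs ! k ^ N) a) N"
  unfolding cech_diff_def cochain_def[of xs "i + 1"]
proof (rule restrict_ext)
  fix I assume I: "I \<in> index_sets (length xs) (i + 1)"
  note Isub = index_sets_subset[OF I]
  have fin: "finite I" using Isub finite_subset by blast
  note G = sub_prod_mem[OF xs Isub]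
  interpret abelian_group "L (sub_prod xs I)" by (rule abelian_group_L[OF G])
  have mem: "pos_sign I k * (xs ! k ^ N * a (I - {k})) \<in> S" if k: "k \<in> I" for k
  proof -
    have "xs ! k \<in> S" by (rule nth_mem_S[OF xs Isub k])
    then show ?thesis using a[OF index_sets_remove[OF I k]] by simp
  qed
  have term_eq: "alt_sign R I k \<odot>\<^bsub>L (sub_prod xs I)\<^esub>
      loc_map R M (prod_of R xs (I - {k})) (xs ! k) (cochain xs i a N (I - {k}))
    = fraction (sub_prod xs I) (pos_sign I k * (xs ! k ^ N * a (I - {k}))) N" if k: "k \<in> I" for k
  proof -
    note Ik = index_sets_remove[OF I k]
    have xk: "xs ! k \<in> S" by (rule nth_mem_S[OF xs Isub k])
    show ?thesis
      using L_smult[OF G, of "xs ! k ^ N * a (I - {k})" "pos_sign I k" N] a[OF Ik] xk Ik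
        loc_map_fraction[OF sub_prod_mem[OF xs index_sets_subset[OF Ik]] xk a[OF Ik], of N]
      by (simp add: cochain_def prod_of_eq[OF xs index_sets_subset[OF Ik]] sub_prod_remove[OF fin k] alt_sign_R)
  qed
  have "(\<Oplus>\<^bsub>L (sub_prod xs I)\<^esub>k\<in>I. alt_sign R I k \<odot>\<^bsub>L (sub_prod xs I)\<^esub>
        loc_map R M (prod_of R xs (I - {k})) (xs ! k) (cochain xs i a N (I - {k})))
      = (\<Oplus>\<^bsub>L (sub_prod xs I)\<^esub>k\<in>I. fraction (sub_prod xs I) (pos_sign I k * (xs ! k ^ N * a (I - {k}))) N)"
    by (rule finsum_cong') (auto simp: term_eq mem)
  also have "\<dots> = fraction (sub_prod xs I) (koszul_d (\<lambda>k. xs ! k ^ N) a I) N"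
    unfolding koszul_d_def by (rule finsum_L_fraction[OF G fin mem])
  finally show "(\<Oplus>\<^bsub>L (prod_of R xs I)\<^esub>k\<in>I. alt_sign R I k \<odot>\<^bsub>L (prod_of R xs I)\<^esub>
        loc_map R M (prod_of R xs (I - {k})) (xs ! k) (cochain xs i a N (I - {k})))
      = fraction (sub_prod xs I) (koszul_d (\<lambda>k. xs ! k ^ N) a I) N"
    by (simp only: prod_of_eq[OF xs Isub])
qed

lemma cech_diff_mem:
  assumes xs: "set xs \<subseteq> S" and x: "x \<in> carrier (cech_group R M xs i)"
  shows "cech_diff R M xs i x \<in> carrier (cech_group R M xs (i + 1))"
proof -
  obtain a N where a: "\<And>I. a I \<in> S" "x = cochain xs i a N" using cochain_cases[OF xs x] by blast
  show ?thesis
    unfolding a(2) cech_diff_cochain[OF xs a(1)]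
    by (rule cochain_mem[OF xs koszul_d_mem[OF xs index_sets_subset a(1)]])
qed

lemma group_hom_cech_diff:
  assumes xs: "set xs \<subseteq> S"
  shows "group_hom (cech_group R M xs i) (cech_group R M xs (i + 1)) (cech_diff R M xs i)"
proof (intro group_hom.intro group_hom_axioms.intro group_cech_group[OF xs] homI)
  fix x y assume x: "x \<in> carrier (cech_group R M xs i)" and y: "y \<in> carrier (cech_group R M xs i)"
  obtain a N where a: "\<And>I. a I \<in> S" "x = cochain xs i a N" using cochain_cases[OF xs x] by blast
  obtain b N' where b: "\<And>I. b I \<in> S" "y = cochain xs i b N'" using cochain_cases[OF xs y] by blast
  let ?A = "index_sets (length xs) i" and ?P = "N + N'"
  define a' where "a' I = (if I \<in> ?A then sub_prod xs I ^ N' * a I else 0)" for I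
  define b' where "b' I = (if I \<in> ?A then sub_prod xs I ^ N * b I else 0)" for I
  have S: "a' I \<in> S" "b' I \<in> S" for I
    using a(1) b(1) sub_prod_mem[OF xs index_sets_subset] by (auto simp: a'_def b'_def)
  have x': "x = cochain xs i a' ?P"
    using cochain_expand[OF xs a(1), where i = i and c = N' and N = N] by (simp add: a(2) cochain_def a'_def cong: restrict_cong)
  have y': "y = cochain xs i b' ?P"
    using cochain_expand[OF xs b(1), where i = i and c = N and N = N'] by (simp add: b(2) cochain_def b'_def add.commute cong: restrict_cong)
  have dS: "koszul_d (\<lambda>k. xs ! k ^ ?P) a' I \<in> S" "koszul_d (\<lambda>k. xs ! k ^ ?P) b' I \<in> S"
    if "I \<in> index_sets (length xs) (i + 1)" for I
    using that S by (auto intro!: koszul_d_mem[OF xs index_sets_subset])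
  show "cech_diff R M xs i (x \<otimes>\<^bsub>cech_group R M xs i\<^esub> y)
     = cech_diff R M xs i x \<otimes>\<^bsub>cech_group R M xs (i + 1)\<^esub> cech_diff R M xs i y"
    unfolding x' y' using S dS
    by (simp add: cochain_mult[OF xs] cech_diff_cochain[OF xs] koszul_d_add[abs_def])
qed (rule cech_diff_mem[OF xs])

text \<open>A cochain is zero when each numerator is annihilated by a power of its denominator; one power serves
  all index sets, as there are finitely many.\<close>

lemma cochain_eq_one_iff:
  assumes xs: "set xs \<subseteq> S" and a: "\<And>I. I \<in> index_sets (length xs) i \<Longrightarrow> a I \<in> S"
  shows "cochain xs i a N = \<one>\<^bsub>cech_group R M xs i\<^esub> \<longleftrightarrow>
    (\<exists>c. \<forall>I \<in> index_sets (length xs) i. sub_prod xs I ^ c * a I \<in> ring_module.span T)"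
    (is "_ \<longleftrightarrow> ?rhs")
proof
  let ?A = "index_sets (length xs) i"
  have G: "sub_prod xs I \<in> S" if "I \<in> ?A" for I by (rule sub_prod_mem[OF xs index_sets_subset[OF that]])
  assume eq: "cochain xs i a N = \<one>\<^bsub>cech_group R M xs i\<^esub>"
  have "\<exists>c. sub_prod xs I ^ c * a I \<in> ring_module.span T" if I: "I \<in> ?A" for I
  proof -
    have "fraction (sub_prod xs I) (a I) N = fraction (sub_prod xs I) 0 N"
      using fun_cong[OF eq, of I] I unfolding one_cech_group[OF xs, of i N] by (simp add: cochain_def)
    then show ?thesis by (auto simp: fraction_eq_iff G[OF I] a[OF I])
  qed
  then obtain c where c: "\<And>I. I \<in> ?A \<Longrightarrow> sub_prod xs I ^ c I * a I \<in> ring_module.span T" by metis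
  have "sub_prod xs I ^ (\<Sum>I\<in>?A. c I) * a I \<in> ring_module.span T" if I: "I \<in> ?A" for I
  proof -
    have "(\<Sum>I\<in>?A. c I) = (\<Sum>I\<in>?A - {I}. c I) + c I"
      using I by (simp add: sum.remove finite_index_sets)
    then show ?thesis using ideal_mult_left[OF c[OF I]] by (simp add: power_add mult.assoc)
  qed
  then show ?rhs by blast
next
  assume ?rhs
  then obtain c where c: "\<And>I. I \<in> index_sets (length xs) i \<Longrightarrow> sub_prod xs I ^ c * a I \<in> ring_module.span T" by blast
  have "cochain xs i a N = cochain xs i (\<lambda>I. sub_prod xs I ^ c * a I) (N + c)"
    by (rule cochain_expand[OF xs a, symmetric])
  also have "\<dots> = cochain xs i (\<lambda>_. 0) (N + c)"
    unfolding cochain_def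
  proof (rule restrict_ext)
    fix I assume I: "I \<in> index_sets (length xs) i"
    show "fraction (sub_prod xs I) (sub_prod xs I ^ c * a I) (N + c) = fraction (sub_prod xs I) 0 (N + c)"
      using sub_prod_mem[OF xs index_sets_subset[OF I]] a[OF I] c[OF I] by (intro fraction_congI) auto
  qed
  finally show "cochain xs i a N = \<one>\<^bsub>cech_group R M xs i\<^esub>" by (simp only: one_cech_group[OF xs, of i "N + c"])
qed

text \<open>The Cech complex is the direct limit over \<open>N\<close> of the Koszul complexes of the \<open>N\<close>-th powers, so it
  suffices that each of these has no cohomology in degree \<open>i\<close>.\<close>

theorem cech_vanishing:
  assumes xs: "set xs \<subseteq> S" and i: "0 \<le> i" "i < int t"
    and reg: "\<And>N. \<exists>ys. regular_seq T ys \<and> t = length ys \<and> set ys \<subseteq> (\<lambda>x. x ^ N) ` set xs"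
  shows "trivial_group (cech_cohomology R M xs i)"
  unfolding cech_cohomology_def
proof (rule trivial_group_cohomologyI)
  let ?m = "length xs"
  let ?K = "kernel (cech_group R M xs i) (cech_group R M xs (i + 1)) (cech_diff R M xs i)"
  show "group_hom (cech_group R M xs i) (cech_group R M xs (i + 1)) (cech_diff R M xs i)"
    by (rule group_hom_cech_diff[OF xs])
  show "cech_diff R M xs (i - 1) y \<in> ?K" if y: "y \<in> carrier (cech_group R M xs (i - 1))" for y
  proof -
    obtain a N where a: "\<And>I. a I \<in> S" "y = cochain xs (i - 1) a N" using cochain_cases[OF xs y] by blast
    let ?d = "koszul_d (\<lambda>k. xs ! k ^ N)"
    have dy: "cech_diff R M xs (i - 1) y = cochain xs i (?d a) N"
      using cech_diff_cochain[OF xs a(1), where i = "i - 1" and N = N] by (simp add: a(2))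
    have dS: "?d a I \<in> S" if "I \<in> index_sets ?m i" for I
      by (rule koszul_d_mem[OF xs index_sets_subset[OF that] a(1)])
    have "cech_diff R M xs i (cech_diff R M xs (i - 1) y) = cochain xs (i + 1) (?d (?d a)) N"
      unfolding dy by (rule cech_diff_cochain[OF xs dS])
    also have "\<dots> = cochain xs (i + 1) (\<lambda>_. 0) N"
      unfolding cochain_def
      by (intro restrict_ext) (metis koszul_d_koszul_d finite_lessThan finite_subset index_sets_subset)
    finally show ?thesis
      using cech_diff_mem[OF xs y] by (simp add: kernel_def one_cech_group[OF xs, of _ N])
  qed
  show "\<exists>y\<in>carrier (cech_group R M xs (i - 1)). cech_diff R M xs (i - 1) y = x" if xK: "x \<in> ?K" for x
  proof -
    have x: "x \<in> carrier (cech_group R M xs i)" and dx: "cech_diff R M xs i x = \<one>\<^bsub>cech_group R M xs (i + 1)\<^esub>"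
      using xK by (auto simp: kernel_def)
    obtain a N where a: "\<And>I. a I \<in> S" "x = cochain xs i a N" using cochain_cases[OF xs x] by blast
    have "cochain xs (i + 1) (koszul_d (\<lambda>k. xs ! k ^ N) a) N = \<one>\<^bsub>cech_group R M xs (i + 1)\<^esub>"
      using dx cech_diff_cochain[OF xs a(1), where i = i and N = N] by (simp add: a(2))
    moreover have "koszul_d (\<lambda>k. xs ! k ^ N) a I \<in> S" if "I \<in> index_sets ?m (i + 1)" for I
      by (rule koszul_d_mem[OF xs index_sets_subset[OF that] a(1)])
    ultimately obtain c where c: "\<And>I. I \<in> index_sets ?m (i + 1) \<Longrightarrow>
        sub_prod xs I ^ c * koszul_d (\<lambda>k. xs ! k ^ N) a I \<in> ring_module.span T"
      using cochain_eq_one_iff[OF xs, of "i + 1" "koszul_d (\<lambda>k. xs ! k ^ N) a" N] by blast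
    \<comment> \<open>Multiplying numerators and denominators by the \<open>c\<close>-th powers turns a family that is closed only
      after multiplication by a power into one that is closed modulo the ideal.\<close>
    define P where "P = N + c"
    define a' where "a' I = sub_prod xs I ^ c * a I" for I
    let ?d = "koszul_d (\<lambda>k. xs ! k ^ P)"
    have x': "x = cochain xs i a' P"
      using cochain_expand[OF xs a(1), where i = i and c = c and N = N] by (simp add: a(2) a'_def[abs_def] P_def)
    have cocycle: "?d a' I \<in> ring_module.span T" if I: "I \<in> index_sets ?m (i + 1)" for I
    proof -
      have fin: "finite I" using index_sets_subset[OF I] finite_subset by blast
      have "?d a' I = sub_prod xs I ^ c * koszul_d (\<lambda>k. xs ! k ^ N) a I"
        unfolding koszul_d_def sum_distrib_left
      proof (rule sum.cong[OF refl])
        fix k assume k: "k \<in> I"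
        have "sub_prod xs I ^ c = sub_prod xs (I - {k}) ^ c * xs ! k ^ c"
          using sub_prod_remove[OF fin k, of xs] by (metis power_mult_distrib)
        then show "pos_sign I k * (xs ! k ^ P * a' (I - {k}))
            = sub_prod xs I ^ c * (pos_sign I k * (xs ! k ^ N * a (I - {k})))"
          by (simp add: a'_def P_def power_add mult_ac)
      qed
      then show ?thesis using c[OF I] by simp
    qed
    obtain ys where ys: "regular_seq T ys" "t = length ys" "set ys \<subseteq> (\<lambda>x. x ^ P) ` set xs"
      using reg[of P] by blast
    have "\<exists>b. \<forall>I. I \<subseteq> {..<?m} \<longrightarrow> card I = nat i \<longrightarrow> a' I - ?d b I \<in> ring_module.span T"
    proof (rule koszul_vanishing[OF ys(1)])
      show "set ys \<subseteq> (\<lambda>k. xs ! k ^ P) ` {..<?m}"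
        using ys(3) by (force simp: in_set_conv_nth)
      show "nat i < length ys" using ys(2) i by simp
      show "?d a' I \<in> ring_module.span T" if "I \<subseteq> {..<?m}" "card I = Suc (nat i)" for I
        by (rule cocycle) (use that i in \<open>simp add: index_sets_def\<close>)
    qed
    then obtain b where "\<And>I. I \<subseteq> {..<?m} \<Longrightarrow> card I = nat i \<Longrightarrow> a' I - ?d b I \<in> ring_module.span T"
      by blast
    then have b: "a' I - ?d b I \<in> ring_module.span T" if "I \<in> index_sets ?m i" for I
      using that by (auto simp: index_sets_def)
    define y where "y = cochain xs (i - 1) (\<lambda>I. \<pi> (b I)) P"
    have "y \<in> carrier (cech_group R M xs (i - 1))"
      unfolding y_def by (rule cochain_mem[OF xs]) simp
    moreover have "cech_diff R M xs (i - 1) y = cochain xs i (?d (\<lambda>I. \<pi> (b I))) P"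
      using cech_diff_cochain[OF xs, of "i - 1" "\<lambda>I. \<pi> (b I)" P] by (simp add: y_def)
    moreover have "cochain xs i (?d (\<lambda>I. \<pi> (b I))) P = x"
      unfolding x' cochain_def
    proof (rule restrict_ext)
      fix I assume I: "I \<in> index_sets ?m i"
      note G = sub_prod_mem[OF xs index_sets_subset[OF I]]
      have a'S: "a' I \<in> S" using G a(1) by (simp add: a'_def)
      have xk: "xs ! k ^ P \<in> S" if "k \<in> I" for k using nth_mem_S[OF xs index_sets_subset[OF I] that] by simp
      have "\<pi> (a' I - ?d b I) \<in> ring_module.span T"
        using retract_span[OF T_sub b[OF I]] by (simp add: J_eq)
      moreover have "\<pi> (a' I - ?d b I) = a' I - ?d (\<lambda>I. \<pi> (b I)) I"
        using retract_koszul_d[of I "\<lambda>k. xs ! k ^ P" b] xk by (simp add: retract_diff retract_self[OF a'S])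
      ultimately have "- (a' I - ?d (\<lambda>I. \<pi> (b I)) I) \<in> ring_module.span T"
        using ring_module.span_neg by metis
      then show "fraction (sub_prod xs I) (?d (\<lambda>I. \<pi> (b I)) I) P = fraction (sub_prod xs I) (a' I) P"
        by (intro fraction_congI G a'S koszul_d_mem[OF xs index_sets_subset[OF I]]) simp_all
    qed
    ultimately show ?thesis by blast
  qed
qed

end

section \<open>The polynomial ring as a retract\<close>

definition restrict_vars :: "'v set \<Rightarrow> 'w set \<Rightarrow> ('v, 'w, 'k::zero) bipoly \<Rightarrow> ('v, 'w, 'k) bipoly" where
  "restrict_vars V W = filter2 (\<lambda>\<alpha> \<mu>. Poly_Mapping.keys \<alpha> \<subseteq> V \<and> Poly_Mapping.keys \<mu> \<subseteq> W)"

lemma poly_over_poly_over_iff: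
  "p \<in> poly_over (poly_over UNIV W) V \<longleftrightarrow>
    (\<forall>\<alpha> \<mu>. coeff2 p \<alpha> \<mu> \<noteq> 0 \<longrightarrow> Poly_Mapping.keys \<alpha> \<subseteq> V \<and> Poly_Mapping.keys \<mu> \<subseteq> W)"
  for p :: "('v, 'w, 'k::comm_ring_1) bipoly"
proof -
  have "\<alpha> \<in> Poly_Mapping.keys p \<longleftrightarrow> (\<exists>\<mu>. \<mu> \<in> Poly_Mapping.keys (Poly_Mapping.lookup p \<alpha>))" for \<alpha>
    unfolding in_keys_iff by (metis lookup_zero poly_mapping_eqI)
  then show ?thesis
    unfolding poly_over_def coeff2_def in_keys_iff[symmetric] by (auto, blast+)
qed

lemma keys_add_nat: "Poly_Mapping.keys (\<alpha> + \<beta>) = Poly_Mapping.keys \<alpha> \<union> Poly_Mapping.keys \<beta>"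
  for \<alpha> \<beta> :: "'v \<Rightarrow>\<^sub>0 nat"
  by (auto simp: in_keys_iff lookup_add)

text \<open>The product of a monomial in the given variables with any monomial \<open>m\<close> involves only these
  variables exactly when \<open>m\<close> does; this makes the projection linear over the subring.\<close>

lemma retract_subring_poly_over:
  "retract_subring (poly_over (poly_over UNIV W) V :: ('v, 'w, 'k::comm_ring_1) bipoly set) (restrict_vars V W)"
proof -
  let ?S = "poly_over (poly_over UNIV W) V :: ('v, 'w, 'k) bipoly set"
  have self: "restrict_vars V W p = p" if "p \<in> ?S" for p
    unfolding restrict_vars_def by (rule filter2_eq_self) (use that in \<open>auto simp: poly_over_poly_over_iff\<close>)
  have mem: "restrict_vars V W p \<in> ?S" for p :: "('v, 'w, 'k) bipoly"
    by (auto simp: poly_over_poly_over_iff restrict_vars_def coeff2_filter2 split: if_splits)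
  have mult: "restrict_vars V W (q * p) = q * restrict_vars V W p" if "q \<in> ?S" for p q
    unfolding restrict_vars_def
    by (rule filter2_mult) (use that in \<open>auto simp: poly_over_poly_over_iff keys_add_nat\<close>)
  have one: "(1 :: ('v, 'w, 'k) bipoly) = monom2 0 0 1" by (simp add: monom2_def)
  show ?thesis
  proof
    show "x * y \<in> ?S" if "x \<in> ?S" "y \<in> ?S" for x y
      using mem[of "x * y"] mult[OF that(1), of y] self[OF that(2)] by simp
    show "x + y \<in> ?S" if "x \<in> ?S" "y \<in> ?S" for x y
      using mem[of "x + y"] self that by (simp add: restrict_vars_def filter2_add)
    show "- x \<in> ?S" if "x \<in> ?S" for x
      using that by (auto simp: poly_over_poly_over_iff coeff2_def)
    show "1 \<in> ?S" unfolding one by (auto simp: poly_over_poly_over_iff coeff2_monom2 split: if_splits)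
  qed (simp_all add: self mem mult, simp_all add: restrict_vars_def filter2_add poly_over_poly_over_iff)
qed

lemma retract_subring_ring_C:
  "retract_subring (poly_over (ring_A s n r d) (X_vars s n) :: 'k::idom gen_poly set)
     (restrict_vars (X_vars s n) (U_vars s n r d))"
  unfolding ring_A_def by (rule retract_subring_poly_over)

lemma generic_polys_subset:
  "set (generic_polys s n r d) \<subseteq> (poly_over (ring_A s n r d) (X_vars s n) :: 'k::idom gen_poly set)"
proof
  fix p :: "'k gen_poly" assume "p \<in> set (generic_polys s n r d)"
  then obtain i where i: "i \<in> {1..r}" "p = generic_poly s n d i" unfolding generic_polys_def by (force simp del: upt_Suc)
  interpret retract_subring "poly_over (ring_A s n r d) (X_vars s n) :: 'k gen_poly set"
    "restrict_vars (X_vars s n) (U_vars s n r d)" by (rule retract_subring_ring_C)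
  show "p \<in> poly_over (ring_A s n r d) (X_vars s n)"
    unfolding i(2) generic_poly_def
  proof (rule sum_mem)
    fix \<alpha> assume \<alpha>: "\<alpha> \<in> expos s n (d i)"
    have monom: "(Poly_Mapping.single \<alpha> (var_U i \<alpha>) :: 'k gen_poly) = monom2 \<alpha> (Poly_Mapping.single (i, \<alpha>) 1) 1"
      by (simp add: monom2_def var_U_def)
    show "Poly_Mapping.single \<alpha> (var_U i \<alpha>) \<in> (poly_over (ring_A s n r d) (X_vars s n) :: 'k gen_poly set)"
      unfolding monom using \<alpha> i(1)
      by (auto simp: ring_A_def poly_over_poly_over_iff coeff2_monom2 U_vars_def expos_def split: if_splits)
  qed
qed

lemma sigmas_subset:
  "set (sigmas s n) \<subseteq> (poly_over (ring_A s n r d) (X_vars s n) :: 'k::idom gen_poly set)"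
proof
  fix p :: "'k gen_poly" assume "p \<in> set (sigmas s n)"
  then obtain t where t: "t \<in> set (product_lists (map (\<lambda>j. [1..<n j + 2]) [1..<s + 1]))"
    and p: "p = (\<Prod>j = 1..s. var_X j (t ! (j - 1)))"
    unfolding sigmas_def by auto
  interpret retract_subring "poly_over (ring_A s n r d) (X_vars s n) :: 'k gen_poly set"
    "restrict_vars (X_vars s n) (U_vars s n r d)" by (rule retract_subring_ring_C)
  show "p \<in> poly_over (ring_A s n r d) (X_vars s n)"
    unfolding p
  proof (rule prod_mem)
    fix j assume j: "j \<in> {1..s}"
    have "t ! (j - 1) \<in> set (map (\<lambda>j. [1..<n j + 2]) [1..<s + 1] ! (j - 1))"
    proof -
      have "j - 1 < length t" using t j by (auto dest: in_set_product_lists_length)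
      then show ?thesis using t unfolding product_lists_set by (auto simp only: mem_Collect_eq list_all2_conv_all_nth)
    qed
    then have "(j, t ! (j - 1)) \<in> X_vars s n" using j by (auto simp: X_vars_def simp del: upt_Suc)
    moreover have "(var_X j (t ! (j - 1)) :: 'k gen_poly) = monom2 (Poly_Mapping.single (j, t ! (j - 1)) 1) 0 1"
      by (simp add: monom2_def var_X_def)
    ultimately show "var_X j (t ! (j - 1)) \<in> (poly_over (ring_A s n r d) (X_vars s n) :: 'k gen_poly set)"
      by (auto simp: ring_A_def poly_over_poly_over_iff coeff2_monom2 split: if_splits)
  qed
qed

theorem proposition4p5:
  fixes s r :: nat and n :: "nat \<Rightarrow> nat" and d :: "nat \<Rightarrow> nat \<Rightarrow> nat"
  assumes "s \<ge> 1"
    and "n 1 \<ge> 1"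
    and "\<And>j. 1 \<le> j \<Longrightarrow> j < s \<Longrightarrow> n j \<le> n (j + 1)"
    and "\<And>i j. 1 \<le> i \<Longrightarrow> i \<le> r \<Longrightarrow> 1 \<le> j \<Longrightarrow> j \<le> s \<Longrightarrow> d i j \<ge> 1"
    and "r \<le> n 1 + 1"
  shows "(\<forall>i::int. i \<noteq> 0 \<longrightarrow>
            trivial_group (koszul_cohomology
              (ring_C s n r d :: 'k::idom gen_poly ring) (generic_polys s n r d) i)) \<and>
         (r < n 1 + 1 \<longrightarrow> (\<forall>i::int. 0 \<le> i \<and> i < int (n 1) + 1 - int r \<longrightarrow>
            trivial_group (cech_cohomology
              (ring_C s n r d :: 'k gen_poly ring) (module_B s n r d) (sigmas s n) i)))"
proof -
  let ?S = "poly_over (ring_A s n r d) (X_vars s n) :: 'k gen_poly set"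
  let ?F = "generic_polys s n r d :: 'k gen_poly list"
  have n_mono: "n 1 \<le> n j" if "j \<in> {1..s}" for j
  proof -
    have "1 \<le> j" "j \<le> s" using that by auto
    then show ?thesis
    proof (induction j rule: dec_induct)
      case (step j)
      then show ?case using assms(3)[of j] by simp
    qed simp
  qed
  interpret retract_quotient ?S "restrict_vars (X_vars s n) (U_vars s n r d)" "set ?F"
    by (intro retract_quotient.intro retract_quotient_axioms.intro retract_subring_ring_C generic_polys_subset)
  have "trivial_group (koszul_cohomology (ring_C s n r d) ?F i)" if "i \<noteq> 0" for i
    unfolding ring_C_def
    by (rule koszul_acyclic[OF generic_polys_subset _ that]) (rule regular_seq_generic_polys[where s = s and n = n, OF n_mono assms(5)])
  moreover have "trivial_group (cech_cohomology (ring_C s n r d) (module_B s n r d) (sigmas s n :: 'k gen_poly list) i)"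
    if i: "0 \<le> i" "i < int (n 1) + 1 - int r" for i
    unfolding module_B_def unfolding ring_C_def
  proof (rule cech_vanishing[OF sigmas_subset i(1)])
    show "i < int (n 1 + 1 - r)" using i by simp
    fix N
    let ?ys = "map (diag_monom s N) [r + 1..<n 1 + 2] :: 'k gen_poly list"
    have "set ?ys \<subseteq> (\<lambda>x. x ^ N) ` set (sigmas s n)"
    proof
      fix y assume "y \<in> set ?ys"
      then obtain k where k: "y = diag_monom s N k" "1 \<le> k" "k \<le> n 1 + 1" by auto
      have "k \<in> {1..n j + 1}" if "j \<in> {1..s}" for j using n_mono[OF that] k by simp
      then show "y \<in> (\<lambda>x. x ^ N) ` set (sigmas s n)" unfolding k(1) by (rule diag_monom_in_sigmas_powers)
    qed
    moreover have "regular_seq (set ?F) ?ys" by (rule regular_seq_diag_monoms[where s = s and n = n, OF n_mono assms(5)])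
    ultimately show "\<exists>ys. regular_seq (set ?F) ys \<and> n 1 + 1 - r = length ys \<and> set ys \<subseteq> (\<lambda>x. x ^ N) ` set (sigmas s n)"
      by (intro exI[of _ ?ys]) (simp del: upt_Suc)
  qed
  ultimately show ?thesis by blast
qed

end
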